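(* Let $p$ be an odd prime, $D_{2p}=\langle \tau,\sigma\mid \tau^p=\sigma^2=e,\ \sigma\tau\sigma=\tau^{-1}\rangle$, and for $0\le k\le 2p-1$ let $\mathcal{M}_k'$ be the number of connected Cayley digraphs on $D_{2p}$ of out-degree $k$ up to isomorphism. Then $\mathcal{M}_k'=0$ if $k\in\{0,1\}$; $\mathcal{M}_k'=\mathcal{M}_k-\mathcal{M}_{c,k}$ if $2\le k\le p-1$; and $\mathcal{M}_k'=\mathcal{M}_k$ if $p\le k\le 2p-1$. Here $\mathcal{M}_{c,k}=\frac{1}{p-1}\sum_{d\mid\gcd(p-1,k)}\Phi(d)\binom{\frac{p-1}{d}}{\frac{k}{d}}$, and $\mathcal{M}_k$ is given by: $\mathcal{M}_k=1$ if $k=0$ or $k=2p-1$; $\mathcal{M}_k=\frac{1}{p}\left[\binom{p-1}{k}-\binom{2p-1}{k}\right]+\mathcal{M}_k^1$ if $1\le k\le p-1$; $\mathcal{M}_k=\frac{1}{p}\left[\binom{p-1}{k-p}-\binom{2p-1}{k}\right]+\mathcal{M}_k^1$ if $p\le k\le 2p-2$; with $$\mathcal{M}_k^1=\frac{1}{p-1}\left[\sum_{d\mid\gcd(p-1,k)}\Phi(d)\binom{\frac{2(p-1)}{d}}{\frac{k}{d}}+\sum_{d\mid\gcd(p-1,k-1)}\Phi(d)\binom{\frac{2(p-1)}{d}}{\frac{k-1}{d}}\right],$$ where $\Phi$ is Euler's totient function.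
   Context: For a finite group $G$ and $S\subseteq G$ with $e\notin S$, the Cayley digraph $\mathrm{Cay}(G,S)$ has vertex set $G$ and an arc from $g$ to $h$ whenever $hg^{-1}\in S$; its out-degree is $|S|$, and it is connected if and only if $\langle S\rangle=G$. Note $\gcd(n,0)=n$. *)

theory Defs
  imports
    Complex_Main
    "HOL-Number_Theory.Totient"
    "Graph_Theory.Graph_Theory"
    "HOL-Algebra.Group"
begin

text \<open>Groups given by generators and relations. A letter \<open>(x, True)\<close> stands for the generator
  \<open>x\<close> and \<open>(x, False)\<close> for its formal inverse; a relation \<open>u = v\<close> is a pair of words.\<close>

type_synonym 'x group_word = "('x \<times> bool) list"

inductive_set word_cong :: "('x group_word \<times> 'x group_word) set \<Rightarrow> ('x group_word \<times> 'x group_word) set"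
  for R where
  rel: "(u, v) \<in> R \<Longrightarrow> (u, v) \<in> word_cong R"
| cancel: "([(x, b), (x, \<not> b)], []) \<in> word_cong R"
| refl: "(u, u) \<in> word_cong R"
| sym: "(u, v) \<in> word_cong R \<Longrightarrow> (v, u) \<in> word_cong R"
| trans: "(u, v) \<in> word_cong R \<Longrightarrow> (v, w) \<in> word_cong R \<Longrightarrow> (u, w) \<in> word_cong R"
| append: "(u, v) \<in> word_cong R \<Longrightarrow> (u', v') \<in> word_cong R \<Longrightarrow> (u @ u', v @ v') \<in> word_cong R"

definition presented_group ::
    "('x group_word \<times> 'x group_word) set \<Rightarrow> 'x group_word set monoid" where
  "presented_group R =
    \<lparr> carrier = UNIV // word_cong R,
      mult = (\<lambda>A B. \<Union>u\<in>A. \<Union>v\<in>B. word_cong R `` {u @ v}),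
      one = word_cong R `` {[]} \<rparr>"

lemma equiv_word_cong: "equiv UNIV (word_cong R)"
proof (rule equivI)
  show "refl (word_cong R)" by (rule refl_onI) (rule word_cong.refl)
  show "sym (word_cong R)" by (rule symI) (rule word_cong.sym)
  show "trans (word_cong R)" by (rule transI) (rule word_cong.trans)
qed simp

lemma presented_group_mult:
  "word_cong R `` {u} \<otimes>\<^bsub>presented_group R\<^esub> word_cong R `` {v} = word_cong R `` {u @ v}"
proof -
  have eq: "word_cong R `` {u' @ v'} = word_cong R `` {u @ v}"
    if "u' \<in> word_cong R `` {u}" "v' \<in> word_cong R `` {v}" for u' v'
  proof -
    have "(u @ v, u' @ v') \<in> word_cong R"
      using that by (intro word_cong.append) auto
    from equiv_class_eq[OF equiv_word_cong this] show ?thesis by (rule HOL.sym)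
  qed
  have ne: "u \<in> word_cong R `` {u}" "v \<in> word_cong R `` {v}"
    by (simp_all add: word_cong.refl)
  have "(\<Union>u'\<in>word_cong R `` {u}. \<Union>v'\<in>word_cong R `` {v}. word_cong R `` {u' @ v'})
      = (\<Union>u'\<in>word_cong R `` {u}. \<Union>v'\<in>word_cong R `` {v}. word_cong R `` {u @ v})"
    by (intro SUP_cong HOL.refl eq)
  also have "\<dots> = word_cong R `` {u @ v}"
    using ne by blast
  finally have "(\<Union>u'\<in>word_cong R `` {u}. \<Union>v'\<in>word_cong R `` {v}. word_cong R `` {u' @ v'})
      = word_cong R `` {u @ v}" .
  then show ?thesis
    by (simp add: presented_group_def)
qed

lemma group_presented_group: "group (presented_group R)"
proof -
  let ?G = "presented_group R"
  have car: "A \<in> carrier ?G \<longleftrightarrow> (\<exists>u. A = word_cong R `` {u})" for A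
    by (auto simp: presented_group_def quotient_def)
  have one: "\<one>\<^bsub>?G\<^esub> = word_cong R `` {[]}"
    by (simp add: presented_group_def)
  have inv: "\<exists>v. (v @ u, []) \<in> word_cong R" for u
  proof (induction u)
    case Nil
    show ?case by (rule exI[of _ "[]"]) (simp add: word_cong.refl)
  next
    case (Cons l u)
    then obtain v where v: "(v @ u, []) \<in> word_cong R" by blast
    obtain x b where l: "l = (x, b)" by force
    have "([(x, \<not> b), (x, b)], []) \<in> word_cong R"
      using word_cong.cancel[of x "\<not> b" R] by simp
    from word_cong.append[OF word_cong.refl[of v] word_cong.append[OF this word_cong.refl[of u]]]
    have "(v @ [(x, \<not> b), (x, b)] @ u, v @ u) \<in> word_cong R" by simp
    from word_cong.trans[OF this v] have "((v @ [(x, \<not> b)]) @ l # u, []) \<in> word_cong R"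
      by (simp add: l)
    then show ?case by blast
  qed
  show ?thesis
  proof (rule groupI)
    show "A \<otimes>\<^bsub>?G\<^esub> B \<in> carrier ?G" if "A \<in> carrier ?G" "B \<in> carrier ?G" for A B
      using that unfolding car by (metis presented_group_mult)
    show "\<one>\<^bsub>?G\<^esub> \<in> carrier ?G"
      unfolding car one by blast
    show "A \<otimes>\<^bsub>?G\<^esub> B \<otimes>\<^bsub>?G\<^esub> C = A \<otimes>\<^bsub>?G\<^esub> (B \<otimes>\<^bsub>?G\<^esub> C)"
      if "A \<in> carrier ?G" "B \<in> carrier ?G" "C \<in> carrier ?G" for A B C
      using that unfolding car by (metis presented_group_mult append_assoc)
    show "\<one>\<^bsub>?G\<^esub> \<otimes>\<^bsub>?G\<^esub> A = A" if "A \<in> carrier ?G" for A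
      using that unfolding car one by (metis presented_group_mult append_Nil)
    fix A assume "A \<in> carrier ?G"
    then obtain u where u: "A = word_cong R `` {u}" unfolding car by blast
    obtain v where v: "(v @ u, []) \<in> word_cong R" using inv by blast
    have "word_cong R `` {v} \<otimes>\<^bsub>?G\<^esub> A = \<one>\<^bsub>?G\<^esub>"
      unfolding u one presented_group_mult by (rule equiv_class_eq[OF equiv_word_cong v])
    then show "\<exists>B\<in>carrier ?G. B \<otimes>\<^bsub>?G\<^esub> A = \<one>\<^bsub>?G\<^esub>"
      using car by blast
  qed
qed

datatype dihedral_gen = Tau | Sigma

definition dihedral_rels :: "nat \<Rightarrow> (dihedral_gen group_word \<times> dihedral_gen group_word) set" where
  "dihedral_rels n =
    {(replicate n (Tau, True), []),
     (replicate 2 (Sigma, True), []),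
     ([(Sigma, True), (Tau, True), (Sigma, True)], [(Tau, False)])}"

text \<open>The dihedral group of order \<open>2n\<close> (for \<open>n > 0\<close>).\<close>

definition dihedral_group :: "nat \<Rightarrow> dihedral_gen group_word set monoid" where
  "dihedral_group n = presented_group (dihedral_rels n)"

definition Cay :: "('a, 'm) monoid_scheme \<Rightarrow> 'a set \<Rightarrow> ('a, 'a \<times> 'a) pre_digraph" where
  "Cay G S = with_proj
    \<lparr> pverts = carrier G,
      parcs = {(g, h). g \<in> carrier G \<and> h \<in> carrier G \<and> h \<otimes>\<^bsub>G\<^esub> inv\<^bsub>G\<^esub> g \<in> S} \<rparr>"

text \<open>\<open>Digraph_Component.connected\<close> is connectedness of the underlying undirected graph.\<close>

definition conn_Cayley_digraphs :: "('a, 'm) monoid_scheme \<Rightarrow> nat \<Rightarrow> ('a, 'a \<times> 'a) pre_digraph set" where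
  "conn_Cayley_digraphs G k =
    {X. (\<exists>S. S \<subseteq> carrier G \<and> \<one>\<^bsub>G\<^esub> \<notin> S \<and> X = Cay G S) \<and>
        Digraph_Component.connected X \<and> (\<forall>v\<in>verts X. out_degree X v = k)}"

definition num_conn_Cayley_digraphs :: "('a, 'm) monoid_scheme \<Rightarrow> nat \<Rightarrow> nat" where
  "num_conn_Cayley_digraphs G k =
    card (conn_Cayley_digraphs G k //
      {(X, Y). X \<in> conn_Cayley_digraphs G k \<and> Y \<in> conn_Cayley_digraphs G k \<and> digraph_iso X Y})"

definition M_c :: "nat \<Rightarrow> nat \<Rightarrow> real" where
  "M_c p k = 1 / real (p - 1) *
    (\<Sum>d | d dvd gcd (p - 1) k. real (totient d) * real (((p - 1) div d) choose (k div d)))"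

definition M_1 :: "nat \<Rightarrow> nat \<Rightarrow> real" where
  "M_1 p k = 1 / real (p - 1) *
    ((\<Sum>d | d dvd gcd (p - 1) k.
        real (totient d) * real ((2 * (p - 1) div d) choose (k div d))) +
     (\<Sum>d | d dvd gcd (p - 1) (k - 1).
        real (totient d) * real ((2 * (p - 1) div d) choose ((k - 1) div d))))"

text \<open>Intended for \<open>k \<le> 2 * p - 1\<close> only; the last branch is the range \<open>p \<le> k \<le> 2 * p - 2\<close>.\<close>

definition M :: "nat \<Rightarrow> nat \<Rightarrow> real" where
  "M p k =
    (if k = 0 \<or> k = 2 * p - 1 then 1
     else if k \<le> p - 1 then
       1 / real p * (real ((p - 1) choose k) - real ((2 * p - 1) choose k)) + M_1 p k
     else
       1 / real p * (real ((p - 1) choose (k - p)) - real ((2 * p - 1) choose k)) + M_1 p k)"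

end

theory Submission
  imports Defs "HOL-Algebra.Group_Action" "HOL-Number_Theory.Residue_Primitive_Roots"
    "HOL-Combinatorics.Permutations"
begin

text \<open>Two connected Cayley digraphs on the dihedral group of order \<open>2p\<close> are isomorphic iff their connection
  sets are conjugate under an automorphism of the group (Babai). The rotations act semiregularly with
  two orbits; letting \<open>C\<^sub>p \<times> C\<^sub>p\<close> act on the set of isomorphisms from both sides shows that, modulo \<open>p\<^sup>2\<close>,
  their number is that of the isomorphisms normalizing \<open>C\<^sub>p\<close>, i.e. affine on each orbit. Unless the arcs
  between the two orbits are all present, the affine automorphisms number less than \<open>2p\<^sup>2\<close> and are even in
  number, hence are not a multiple of \<open>p\<^sup>2\<close>, so an affine isomorphism exists. If all these arcs are
  present, isomorphisms preserve the orbits and the same count applies to the cyclic group.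
  The automorphism group is the affine group of \<open>\<int>/p\<close>; its orbits on the connection sets that contain a
  reflection are counted by Burnside's lemma. A set of size \<open>k \<ge> 2\<close> generates iff it contains a
  reflection.\<close>

section \<open>Counting isomorphisms modulo the square of a prime\<close>

text \<open>The obstacle is a digraph whose two orbits can be rotated independently. Its affine
  automorphisms contain a copy of \<open>C\<^sub>p \<times> C\<^sub>p\<close>, their number is a
  multiple of \<open>p\<^sup>2\<close>, and the congruence says nothing. This happens only if the
  arcs between the orbits are all present or all absent, and connectedness excludes the latter. The
  shape of the formula comes from the fixed points in Burnside's lemma. A map with multiplier u
  \<noteq> 1 fixes the identity and exactly one reflection and moves the other 2(p-1) elements in
  cycles of length ord(u). Leaving out or taking the fixed reflection gives the binomials with k and
  with k-1; \<open>M_c\<close> removes the sets without reflections. The p translations (u = 1) do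
  not obey this count: a nontrivial one fixes all rotations and cycles the p reflections, so an
  invariant set contains all reflections and k-p of the p-1 nontrivial rotations. Counting all
  translations as if they were identities and correcting the error produces the terms with factor
  1/p.\<close>

lemma funpow_mod_period:
  assumes "f ^^ p = id"
  shows "f ^^ (n mod p) = f ^^ n"
proof -
  have "f ^^ n = f ^^ (n mod p + p * (n div p))" by simp
  also have "\<dots> = f ^^ (n mod p) \<circ> (f ^^ p) ^^ (n div p)"
    by (simp only: funpow_add funpow_mult mult.commute)
  also have "\<dots> = f ^^ (n mod p)" by (simp add: assms)
  finally show ?thesis by simp
qed

lemma prime_nat_modular_inverse:
  fixes p n :: nat
  assumes "prime p" "\<not> p dvd n"
  obtains m where "m * n mod p = 1"
proof -
  have "coprime n p" using assms by (metis coprime_commute prime_imp_coprime)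
  then obtain m where "[n * m = Suc 0] (mod p)" using cong_solve_coprime_nat by blast
  then have "m * n mod p = 1" using assms prime_gt_1_nat[of p]
    by (simp add: cong_def mult.commute)
  with that show ?thesis by blast
qed

text \<open>Commuting permutations \<open>L\<close>, \<open>R\<close> of order \<open>p\<close> give an action of \<open>C\<^sub>p \<times> C\<^sub>p\<close>; away from the points
  where \<open>R\<close> acts as a power of \<open>L\<close> it is free.\<close>

lemma prime_square_dvd_card_non_normalizing:
  fixes L R :: "'a \<Rightarrow> 'a"
  assumes p: "prime p" and fin: "finite I"
    and LI: "\<And>x. x \<in> I \<Longrightarrow> L x \<in> I" and RI: "\<And>x. x \<in> I \<Longrightarrow> R x \<in> I"
    and comm: "\<And>x. L (R x) = R (L x)"
    and Lp: "L ^^ p = id" and Rp: "R ^^ p = id"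
    and free: "\<And>x. x \<in> I \<Longrightarrow> L x \<noteq> x"
  shows "p\<^sup>2 dvd card (I - {x \<in> I. \<exists>c. R x = (L ^^ c) x})"
proof -
  define J where "J = I - {x \<in> I. \<exists>c. R x = (L ^^ c) x}"
  define act where "act a b x = (L ^^ a) ((R ^^ b) x)" for a b x
  have p0: "p > 0" using p prime_gt_0_nat by blast
  have commL: "(L ^^ a) (R x) = R ((L ^^ a) x)" for a x
    by (induction a) (simp_all add: comm)
  have commLR: "(L ^^ a) ((R ^^ b) x) = (R ^^ b) ((L ^^ a) x)" for a b x
    by (induction b) (simp_all add: commL)
  have act_add: "act a b (act a' b' x) = act (a + a') (b + b') x" for a b a' b' x
    by (simp add: act_def funpow_add commLR)
  have act_mod: "act (a mod p) (b mod p) x = act a b x" for a b x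
    by (simp add: act_def funpow_mod_period[OF Lp] funpow_mod_period[OF Rp])
  have act_dvd: "act a b x = x" if "p dvd a" "p dvd b" for a b x
    using act_mod[of a b x] that by (simp add: act_def)
  have injL: "inj L" and injR: "inj R"
    using Lp Rp p0 by (metis funpow_Suc_right gr0_implies_Suc inj_on_id inj_on_imageI2)+
  have LJ: "L x \<in> J" if "x \<in> J" for x
    using that LI unfolding J_def
    by (auto simp: comm[symmetric] funpow_swap1[symmetric] dest!: injD[OF injL])
  have RJ: "R x \<in> J" if "x \<in> J" for x
    using that RI unfolding J_def by (auto simp: commL dest!: injD[OF injR])
  have actJ: "act a b x \<in> J" if "x \<in> J" for a b x
  proof -
    have "(R ^^ b) x \<in> J" by (induction b) (simp_all add: that RJ)
    then show ?thesis unfolding act_def by (induction a) (simp_all add: LJ)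
  qed
  have act_mult: "act (k * m) (k * n) x = x" if "act m n x = x" for k m n x
    by (induction k) (simp_all add: that act_def[of 0] flip: act_add)
  have stab: "p dvd m \<and> p dvd n" if x: "x \<in> J" and fx: "act m n x = x" for m n x
  proof -
    \<comment> \<open>Otherwise a suitable multiple of the stabilizing pair is (k m, 1) modulo p, so
      \<open>R x\<close> is a power of \<open>L\<close> applied to \<open>x\<close>; such points
      were removed from \<open>J\<close>.\<close>
    have n: "p dvd n"
    proof (rule ccontr)
      assume "\<not> p dvd n"
      then obtain k where k: "k * n mod p = 1" using prime_nat_modular_inverse p by metis
      have "act (k * m) 1 x = x"
        using act_mult[OF fx, of k] act_mod[of "k * m" "k * n" x] act_mod[of "k * m" 1 x] k
          prime_gt_1_nat[OF p] by simp
      then have "act ((p - 1) * (k * m)) 0 (act (k * m) 1 x) = (L ^^ ((p - 1) * (k * m))) x"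
        by (simp add: act_def)
      moreover have "(p - 1) * (k * m) + k * m = p * (k * m)"
        using p0 by (cases p) simp_all
      ultimately have "act (p * (k * m)) 1 x = (L ^^ ((p - 1) * (k * m))) x"
        by (simp add: act_add)
      moreover have "act (p * (k * m)) 1 x = R x"
        using act_dvd[of "p * (k * m)" 0 "R x"] by (simp add: act_def)
      ultimately have "R x = (L ^^ ((p - 1) * (k * m))) x" by (rule HOL.trans[OF HOL.sym, rotated])
      then show False using x unfolding J_def by blast
    qed
    \<comment> \<open>Now p divides n, so a multiple of the pair is (1, 0) modulo p and
      \<open>L\<close> would fix \<open>x\<close>, against \<open>free\<close>.\<close>
    moreover have "p dvd m"
    proof (rule ccontr)
      assume "\<not> p dvd m"
      then obtain k where k: "k * m mod p = 1" using prime_nat_modular_inverse p by metis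
      have "act 1 0 x = x"
        using act_mult[OF fx, of k] act_mod[of "k * m" "k * n" x] k n by simp
      then show False using x free by (simp add: act_def J_def)
    qed
    ultimately show ?thesis by simp
  qed
  define r where "r = {(x, y). x \<in> J \<and> (\<exists>a b. y = act a b x)}"
  have eqv: "equiv J r"
  proof (rule equivI)
    show "r \<subseteq> J \<times> J" by (auto simp: r_def actJ)
    show "refl_on J r"
      by (rule refl_onI) (auto simp: r_def intro!: exI[of _ "0::nat"] simp: act_def)
    show "sym r"
    proof (rule symI, clarsimp simp: r_def actJ)
      fix x a b
      \<comment> \<open>Exponents are naturals; the factor p - 1 acts as -1.\<close>
      have "(p - 1) * n + n = p * n" for n
        using p0 by (cases p) simp_all
      then have "x = act ((p - 1) * a) ((p - 1) * b) (act a b x)"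
        by (simp add: act_add act_dvd)
      then show "\<exists>a' b'. x = act a' b' (act a b x)" by blast
    qed
    show "trans r" by (rule transI) (clarsimp simp: r_def act_add, blast)
  qed
  have "p\<^sup>2 dvd card X" if X_class: "X \<in> J // r" for X
  proof -
    obtain x where x: "x \<in> J" and X: "X = r `` {x}" using X_class by (rule quotientE)
    \<comment> \<open>As stabilizers are trivial modulo p, each class is a copy of the p by p grid
      of exponent pairs.\<close>
    have "X = (\<lambda>(a, b). act a b x) ` ({0..<p} \<times> {0..<p})"
    proof
      show "X \<subseteq> (\<lambda>(a, b). act a b x) ` ({0..<p} \<times> {0..<p})"
      proof
        fix y assume "y \<in> X"
        then obtain a b where "y = act (a mod p) (b mod p) x" unfolding X r_def act_mod by blast
        then show "y \<in> (\<lambda>(a, b). act a b x) ` ({0..<p} \<times> {0..<p})"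
          using p0 by (intro image_eqI[of _ _ "(a mod p, b mod p)"]) simp_all
      qed
    qed (use X x in \<open>auto simp: r_def\<close>)
    moreover have "inj_on (\<lambda>(a, b). act a b x) ({0..<p} \<times> {0..<p})"
    proof (rule inj_onI, clarsimp)
      fix a b a' b' assume lt: "a < p" "b < p" "a' < p" "b' < p" and eq: "act a b x = act a' b' x"
      have "act (p - a' + a) (p - b' + b) x = act (p - a' + a') (p - b' + b') x"
        using eq by (simp flip: act_add)
      also have "\<dots> = x" using lt by (simp add: act_dvd)
      finally have "p dvd p - a' + a" "p dvd p - b' + b" using stab[OF x] by blast+
      moreover have "a = a'" if "p dvd p - a' + a" "a < p" "a' < p" for a a' :: nat
      proof -
        obtain q where q: "p - a' + a = p * q" using \<open>p dvd p - a' + a\<close> by blast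
        have "0 < p * q" "p * q < p * 2" using q that by linarith+
        then have "0 < q" "q < 2" by (simp_all only: nat_0_less_mult_iff mult_less_cancel1)
        then have "q = 1" by simp
        with q that show ?thesis by simp
      qed
      ultimately show "a = a' \<and> b = b'" using lt by blast
    qed
    ultimately show ?thesis by (simp add: card_image power2_eq_square)
  qed
  then show ?thesis using equiv_imp_dvd_card[OF _ eqv] fin unfolding J_def[symmetric]
    by (simp add: J_def)
qed

text \<open>Isomorphisms are permutations of the whole type that fix everything outside
  \<open>V\<close>. Composition and inverse are then those of functions, and finitely many
  isomorphisms exist when \<open>V\<close> is finite.\<close>

definition rel_isos :: "'a set \<Rightarrow> ('a \<Rightarrow> 'a \<Rightarrow> bool) \<Rightarrow> ('a \<Rightarrow> 'a \<Rightarrow> bool) \<Rightarrow> ('a \<Rightarrow> 'a) set" where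
  "rel_isos V Q Q' = {f. f permutes V \<and> (\<forall>x\<in>V. \<forall>y\<in>V. Q x y \<longleftrightarrow> Q' (f x) (f y))}"

lemma rel_isos_comp:
  assumes "f \<in> rel_isos V Q Q'" "g \<in> rel_isos V Q' Q''"
  shows "g \<circ> f \<in> rel_isos V Q Q''"
proof -
  have "f x \<in> V" if "x \<in> V" for x using assms(1) that by (simp add: rel_isos_def permutes_in_image)
  then show ?thesis using assms by (auto simp: rel_isos_def permutes_compose)
qed

lemma rel_isos_inv:
  assumes "f \<in> rel_isos V Q Q'"
  shows "inv_into UNIV f \<in> rel_isos V Q' Q"
proof -
  have f: "f permutes V" using assms by (simp add: rel_isos_def)
  have "inv_into UNIV f x \<in> V" if "x \<in> V" for x
    using that f by (simp add: permutes_in_image permutes_inv)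
  then show ?thesis using assms f
    by (auto simp: rel_isos_def permutes_inv permutes_inverses)
qed

lemma finite_rel_isos: "finite V \<Longrightarrow> finite (rel_isos V Q Q')"
  by (rule finite_subset[OF _ finite_permutations[of V]]) (auto simp: rel_isos_def)

text \<open>The isomorphisms form the coset of \<open>f\<close> under the automorphisms of
  \<open>Q\<close>.\<close>

lemma card_rel_isos:
  assumes "f \<in> rel_isos V Q Q'"
  shows "card (rel_isos V Q Q') = card (rel_isos V Q Q)"
proof -
  have f: "f permutes V" using assms by (simp add: rel_isos_def)
  have "bij_betw (\<lambda>g. f \<circ> g) (rel_isos V Q Q) (rel_isos V Q Q')"
  proof (rule bij_betw_byWitness[where f' = "\<lambda>g. inv_into UNIV f \<circ> g"])
    show "(\<lambda>g. f \<circ> g) ` rel_isos V Q Q \<subseteq> rel_isos V Q Q'"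
      using rel_isos_comp assms by blast
    show "(\<lambda>g. inv_into UNIV f \<circ> g) ` rel_isos V Q Q' \<subseteq> rel_isos V Q Q"
      using rel_isos_comp rel_isos_inv[OF assms] by blast
  qed (simp_all add: permutes_inv_o[OF f] flip: comp_assoc)
  then show ?thesis by (simp add: bij_betw_same_card)
qed

text \<open>These are the exceptional points of the action above when \<open>L\<close> and
  \<open>R\<close> compose with \<open>t\<close> on the left and on the right.\<close>

definition normalizing_isos where
  "normalizing_isos V t Q Q' = {g \<in> rel_isos V Q Q'. \<exists>c. g \<circ> t = t ^^ c \<circ> g}"

text \<open>A Sylow-type argument: \<open>\<langle>t\<rangle> \<times> \<langle>t\<rangle>\<close> acts on the isomorphisms by \<open>g \<mapsto> t\<^sup>a g t\<^sup>b\<close>, so modulo \<open>p\<^sup>2\<close> only the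
  isomorphisms normalizing \<open>\<langle>t\<rangle>\<close> are counted, and there are as many isomorphisms as automorphisms.\<close>

lemma normalizing_iso_exists:
  assumes p: "prime p" and fin: "finite V" and ne: "V \<noteq> {}"
    and tp: "t ^^ p = id" and tfree: "\<And>x. x \<in> V \<Longrightarrow> t x \<noteq> x"
    and t: "t \<in> rel_isos V Q Q" and t': "t \<in> rel_isos V Q' Q'"
    and f: "f \<in> rel_isos V Q Q'"
    and ndvd: "\<not> p\<^sup>2 dvd card (normalizing_isos V t Q Q)"
  shows "\<exists>g. g \<in> normalizing_isos V t Q Q'"
proof -
  have comp_pow: "((\<circ>) t ^^ c) g = t ^^ c \<circ> g" for c g
    by (induction c) (simp_all add: o_assoc)
  have comp_pow': "((\<lambda>g. g \<circ> t) ^^ c) g = g \<circ> t ^^ c" for c g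
    by (induction c arbitrary: g) (simp_all add: o_assoc funpow_swap1 fun_eq_iff)
  have dvd: "p\<^sup>2 dvd card (rel_isos V P P' - normalizing_isos V t P P')"
    if tP: "t \<in> rel_isos V P P" "t \<in> rel_isos V P' P'" for P P'
  proof -
    have "p\<^sup>2 dvd card (rel_isos V P P' -
        {g \<in> rel_isos V P P'. \<exists>c. g \<circ> t = (((\<circ>) t) ^^ c) g})"
    proof (rule prime_square_dvd_card_non_normalizing[OF p])
      show "t \<circ> x \<noteq> x" if "x \<in> rel_isos V P P'" for x
      proof
        assume "t \<circ> x = x"
        obtain v where v: "v \<in> V" using ne by blast
        then have "x v \<in> V" using that by (simp add: rel_isos_def permutes_in_image)
        then show False using tfree \<open>t \<circ> x = x\<close> by (metis comp_apply)
      qed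
    qed (use fin tP rel_isos_comp in
        \<open>auto simp: finite_rel_isos comp_pow comp_pow' tp fun_eq_iff\<close>)
    then show ?thesis by (simp add: comp_pow normalizing_isos_def)
  qed
  have card_eq: "card (rel_isos V P P') =
      card (rel_isos V P P' - normalizing_isos V t P P') + card (normalizing_isos V t P P')" for P P'
  proof -
    have "normalizing_isos V t P P' \<subseteq> rel_isos V P P'" by (auto simp: normalizing_isos_def)
    then show ?thesis using finite_rel_isos[OF fin, of P P']
      by (simp add: card_Diff_subset card_mono finite_subset)
  qed
  have "\<not> p\<^sup>2 dvd card (rel_isos V Q Q)"
    using card_eq[of Q Q] dvd[OF t t] ndvd by (simp add: dvd_add_right_iff)
  then have "\<not> p\<^sup>2 dvd card (normalizing_isos V t Q Q')"
    using card_eq[of Q Q'] dvd[OF t t'] card_rel_isos[OF f] by (simp add: dvd_add_right_iff)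
  then have "normalizing_isos V t Q Q' \<noteq> {}" by auto
  then show ?thesis by blast
qed

section \<open>Isomorphic dihedral Cayley digraphs have affinely equivalent connection sets\<close>

text \<open>The integers 0, ..., p-1 represent the residues modulo p. The tag is a
  \<open>bool\<close> for the dihedral group (rotations and reflections) and a \<open>unit\<close>
  for the cyclic group, so that both share the analysis of affine maps.\<close>

definition layered :: "nat \<Rightarrow> (int \<times> 'b) set" where
  "layered p = {0..<int p} \<times> UNIV"

definition shift :: "nat \<Rightarrow> int \<times> 'b \<Rightarrow> int \<times> 'b" where
  "shift p x = (if x \<in> layered p then ((fst x + 1) mod int p, snd x) else x)"

text \<open>The linear coefficient of a map that is affine on layer \<open>a\<close>. An exponent
  \<open>c\<close> with \<open>g \<circ> t = t ^^ c \<circ> g\<close> is not unique; this residue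
  depends on \<open>g\<close> alone and can serve as a coordinate for counting.\<close>

definition slope :: "nat \<Rightarrow> 'b \<Rightarrow> (int \<times> 'b \<Rightarrow> int \<times> 'b) \<Rightarrow> int" where
  "slope p a g = (fst (g (1, a)) - fst (g (0, a))) mod int p"

text \<open>The pair \<open>(i, a)\<close> encodes \<open>\<sigma>\<^sup>a \<tau>\<^sup>i\<close>, and \<open>dih_diff p x y\<close> is \<open>y x\<^sup>-\<^sup>1\<close>. With this encoding right
  multiplication by \<open>\<tau>\<close> is the same shift on both layers.\<close>

definition dih_diff :: "nat \<Rightarrow> int \<times> bool \<Rightarrow> int \<times> bool \<Rightarrow> int \<times> bool" where
  "dih_diff p x y = ((if snd x then fst x - fst y else fst y - fst x) mod int p, snd x \<noteq> snd y)"

definition dih_arc :: "nat \<Rightarrow> (int \<times> bool) set \<Rightarrow> int \<times> bool \<Rightarrow> int \<times> bool \<Rightarrow> bool" where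
  "dih_arc p S x y \<longleftrightarrow> dih_diff p x y \<in> S"

text \<open>If p does not divide \<open>u\<close>, this is the group automorphism with \<tau>
  \<mapsto> \<open>\<tau>\<^sup>u\<close> and \<sigma> \<mapsto>
  \<open>\<sigma> \<tau>\<^sup>v\<close>.\<close>

definition dih_aff :: "nat \<Rightarrow> int \<Rightarrow> int \<Rightarrow> int \<times> bool \<Rightarrow> int \<times> bool" where
  "dih_aff p u v x = ((u * fst x + (if snd x then v else 0)) mod int p, snd x)"

text \<open>Right multiplication by \<open>\<sigma>\<close>.\<close>

definition dih_flip :: "nat \<Rightarrow> int \<times> bool \<Rightarrow> int \<times> bool" where
  "dih_flip p x = (if x \<in> layered p then ((- fst x) mod int p, \<not> snd x) else x)"

lemma finite_layered: "finite (layered p :: (int \<times> 'b::finite) set)"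
  by (simp add: layered_def)

lemma permutes_if_inverse_on:
  assumes "\<And>x. x \<in> V \<Longrightarrow> f x \<in> V" "\<And>x. x \<in> V \<Longrightarrow> g x \<in> V" "\<And>x. x \<notin> V \<Longrightarrow> f x = x"
    "\<And>x. x \<in> V \<Longrightarrow> g (f x) = x" "\<And>x. x \<in> V \<Longrightarrow> f (g x) = x"
  shows "f permutes V"
  by (rule bij_imp_permutes[OF bij_betw_byWitness[where f' = g]]) (use assms in auto)

lemma affine_mod_simps:
  fixes a b c m :: int
  shows "(a + c * (b mod m)) mod m = (a + c * b) mod m"
    "(c * (b mod m) + a) mod m = (c * b + a) mod m"
    "(a + (b mod m) * c) mod m = (a + b * c) mod m"
    "((b mod m) * c + a) mod m = (b * c + a) mod m"
  by (metis mod_add_right_eq mod_mult_right_eq, metis mod_add_left_eq mod_mult_right_eq,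
      metis mod_add_right_eq mod_mult_left_eq, metis mod_add_left_eq mod_mult_left_eq)

section \<open>Residues modulo p, the shift and the flip\<close>

locale odd_prime =
  fixes p :: nat
  assumes prime_p: "prime p" and odd_p: "odd p"
begin

lemma p_gt_2: "p > 2"
  using prime_ge_2_nat[OF prime_p] odd_p by (cases "p = 2") auto

lemma prime_int_p: "prime (int p)"
  using prime_p by simp

lemma modular_inverse:
  assumes "\<not> int p dvd c"
  obtains c' where "c' * c mod int p = 1" "\<not> int p dvd c'"
proof -
  have "coprime c (int p)" using assms prime_int_p by (metis coprime_commute prime_imp_coprime)
  then obtain c' where "[c * c' = 1] (mod int p)" using cong_solve_coprime_int by blast
  then have c': "c' * c mod int p = 1" using p_gt_2 by (simp add: cong_def mult.commute)
  moreover have "\<not> int p dvd c'"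
  proof
    assume "int p dvd c'"
    then have "c' * c mod int p = 0" by simp
    with c' show False by simp
  qed
  ultimately show ?thesis using that by blast
qed

lemma linear_congruence_solution:
  assumes "\<not> int p dvd c"
  obtains j where "0 \<le> j" "j < int p" "(c * j) mod int p = b mod int p"
proof -
  obtain c' where c': "c' * c mod int p = 1" using modular_inverse assms by blast
  have "(c * ((c' * b) mod int p)) mod int p = ((c' * c mod int p) * b) mod int p"
    by (simp add: mod_simps algebra_simps)
  then have "(c * ((c' * b) mod int p)) mod int p = b mod int p" using c' by simp
  moreover have "0 \<le> (c' * b) mod int p" "(c' * b) mod int p < int p" using p_gt_2 by simp_all
  ultimately show ?thesis using that by blast
qed

text \<open>The step \<open>e\<close> generates the additive group of residues, so some number of
  steps leads from \<open>i\<close> to \<open>j\<close>.\<close>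

lemma constant_if_invariant_under_step:
  assumes e: "\<not> int p dvd e"
    and inv: "\<And>j. P (j mod int p) \<longleftrightarrow> P ((j + e) mod int p)"
  shows "P (i mod int p) \<longleftrightarrow> P (j mod int p)"
proof -
  have step: "P (i mod int p) \<longleftrightarrow> P ((i + int n * e) mod int p)" for n
  proof (induction n)
    case (Suc n)
    then show ?case using inv[of "i + int n * e"] by (simp add: algebra_simps)
  qed simp
  obtain n where n: "0 \<le> n" "(e * n) mod int p = (j - i) mod int p"
    using linear_congruence_solution[OF e] by blast
  have "(i + int (nat n) * e) mod int p = (i + (e * n) mod int p) mod int p"
    using n(1) by (simp add: mod_simps algebra_simps)
  also have "\<dots> = j mod int p" by (simp add: n(2) mod_simps)
  finally show ?thesis using step[of "nat n"] by simp
qed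

lemma mod_eq_self: "0 \<le> i \<Longrightarrow> i < int p \<Longrightarrow> i mod int p = i"
  by simp

lemma mod_p_bounds [simp]: "0 \<le> i mod int p" "i mod int p < int p"
  using p_gt_2 by simp_all

lemma funpow_shift:
  assumes "x \<in> layered p"
  shows "(shift p ^^ n) x = ((fst x + int n) mod int p, snd x)"
proof (induction n)
  case 0
  then show ?case using assms by (cases x) (simp add: layered_def)
next
  case (Suc n)
  then show ?case by (simp add: shift_def layered_def mod_simps algebra_simps)
qed

lemma shift_funpow_p: "shift p ^^ p = id"
proof
  fix x :: "int \<times> 'b"
  show "(shift p ^^ p) x = id x"
  proof (cases "x \<in> layered p")
    case True
    then show ?thesis by (cases x) (simp add: funpow_shift layered_def)
  next
    case False
    have "(shift p ^^ n) x = x" for n by (induction n) (simp_all add: shift_def False)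
    then show ?thesis by simp
  qed
qed

lemma shift_permutes: "shift p permutes layered p"
proof (rule permutes_if_inverse_on[where g = "\<lambda>x. ((fst x - 1) mod int p, snd x)"])
qed (auto simp: shift_def layered_def mod_simps)

lemma shift_neq: "x \<in> layered p \<Longrightarrow> shift p x \<noteq> x"
proof
  assume x: "x \<in> layered p" and "shift p x = x"
  then have "(fst x + 1) mod int p = fst x mod int p"
    by (cases x) (simp add: shift_def layered_def split: if_splits)
  then have "int p dvd 1" by (simp add: mod_eq_dvd_iff)
  then show False using p_gt_2 by simp
qed

text \<open>Right multiplication by \<tau> cancels in \<open>y x\<^sup>-\<^sup>1\<close>, on which
  the arcs depend.\<close>

lemma dih_arc_shift: "shift p \<in> rel_isos (layered p) (dih_arc p S) (dih_arc p S)"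
proof -
  have "dih_diff p (shift p x) (shift p y) = dih_diff p x y" if "x \<in> layered p" "y \<in> layered p" for x y
    using that by (simp add: shift_def dih_diff_def mod_simps)
  then show ?thesis by (simp add: rel_isos_def dih_arc_def shift_permutes)
qed

lemma dih_flip_permutes: "dih_flip p permutes layered p"
  by (rule permutes_if_inverse_on[where g = "dih_flip p"])
    (auto simp: dih_flip_def layered_def mod_simps)

lemma dih_flip_involution: "dih_flip p \<circ> dih_flip p = id"
  by (auto simp: fun_eq_iff dih_flip_def layered_def mod_simps)

lemma dih_arc_flip: "dih_flip p \<in> rel_isos (layered p) (dih_arc p S) (dih_arc p S)"
proof -
  have "dih_diff p (dih_flip p x) (dih_flip p y) = dih_diff p x y"
    if "x \<in> layered p" "y \<in> layered p" for x y
    using that by (simp add: dih_flip_def dih_diff_def mod_simps)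
  then show ?thesis by (simp add: rel_isos_def dih_arc_def dih_flip_permutes)
qed

text \<open>Iterating \<open>g \<circ> t = t ^^ c \<circ> g\<close> gives
  \<open>g \<circ> t ^^ n = t ^^ (c * n) \<circ> g\<close>. Evaluated at the origin of each layer,
  this makes \<open>g\<close> affine on that layer, with the same slope \<open>c\<close> everywhere;
  injectivity excludes slope 0.\<close>

lemma normalizing_iso_affine:
  fixes g :: "int \<times> 'b \<Rightarrow> int \<times> 'b"
  assumes g: "g \<in> normalizing_isos (layered p) (shift p) Q Q'"
  obtains c where "\<not> int p dvd c"
    "\<And>i a. 0 \<le> i \<Longrightarrow> i < int p \<Longrightarrow> g (i, a) = ((fst (g (0, a)) + c * i) mod int p, snd (g (0, a)))"
    "\<And>a. slope p a g = c mod int p"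
proof -
  obtain c where c: "g \<circ> shift p = shift p ^^ c \<circ> g"
    using g by (auto simp: normalizing_isos_def)
  have perm: "g permutes layered p" using g by (simp add: normalizing_isos_def rel_isos_def)
  have pow: "g ((shift p ^^ n) x) = (shift p ^^ (c * n)) (g x)" for n x
  proof (induction n)
    case (Suc n)
    have "g ((shift p ^^ Suc n) x) = (shift p ^^ c) (g ((shift p ^^ n) x))"
      using fun_cong[OF c, of "(shift p ^^ n) x"] by simp
    also have "\<dots> = (shift p ^^ (c * Suc n)) (g x)" by (simp add: Suc funpow_add)
    finally show ?case .
  qed simp
  have aff: "g (i, a) = ((fst (g (0, a)) + int c * i) mod int p, snd (g (0, a)))"
    if i: "0 \<le> i" "i < int p" for i a
  proof -
    have 0: "(0, a) \<in> layered p" using p_gt_2 by (simp add: layered_def)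
    then have "g (0, a) \<in> layered p" using perm by (simp add: permutes_in_image)
    moreover have "(shift p ^^ nat i) (0, a) = (i, a)" using funpow_shift[OF 0, of "nat i"] i by simp
    ultimately show ?thesis using pow[of "nat i" "(0, a)"] i by (simp add: funpow_shift)
  qed
  moreover have "\<not> int p dvd int c"
  proof
    fix a :: 'b
    assume "int p dvd int c"
    then have "(fst (g (0, a)) + int c * 1) mod int p = (fst (g (0, a)) + int c * 0) mod int p"
      by (metis add.right_neutral dvd_imp_mod_0 mod_add_right_eq mult.right_neutral mult_zero_right)
    then have "g (1, a) = g (0, a)" using aff[of 1 a] aff[of 0 a] p_gt_2 by simp
    from injD[OF permutes_inj[OF perm] this] show False by simp
  qed
  moreover have "slope p a g = int c mod int p" for a
  proof -
    have "fst (g (1, a)) = (fst (g (0, a)) + int c) mod int p" using aff[of 1 a] p_gt_2 by simp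
    then show ?thesis by (simp add: slope_def mod_simps)
  qed
  ultimately show ?thesis using that by blast
qed

text \<open>There are p - 1 nonzero slopes and p possible images of the origin within a layer, hence
  at least one and at most (p-1)p < \<open>p\<^sup>2\<close> elements.\<close>

lemma card_normalizing_isos_bound:
  fixes X :: "(int \<times> 'b \<Rightarrow> int \<times> 'b) set"
  assumes "X \<subseteq> normalizing_isos (layered p) (shift p) Q Q'"
    and inj: "inj_on (\<lambda>g. (slope p a g, fst (g (0, a)))) X"
    and "X \<noteq> {}" "finite X"
  shows "\<not> p\<^sup>2 dvd card X"
proof -
  have "(\<lambda>g. (slope p a g, fst (g (0, a)))) ` X \<subseteq> {1..<int p} \<times> {0..<int p}"
  proof (rule image_subsetI)
    fix g assume "g \<in> X"
    then have g: "g \<in> normalizing_isos (layered p) (shift p) Q Q'" using assms by blast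
    then obtain c where c: "\<not> int p dvd c" "slope p a g = c mod int p"
      using normalizing_iso_affine[OF g] by metis
    have "c mod int p \<noteq> 0" using c(1) by (simp add: dvd_eq_mod_eq_0)
    then have "c mod int p \<in> {1..<int p}"
      using mod_p_bounds[of c] by (simp only: atLeastLessThan_iff simp_thms)
    moreover have "g permutes layered p" using g by (simp add: normalizing_isos_def rel_isos_def)
    then have "g (0, a) \<in> layered p" using p_gt_2 by (simp add: permutes_in_image) (simp add: layered_def)
    ultimately show "(slope p a g, fst (g (0, a))) \<in> {1..<int p} \<times> {0..<int p}"
      unfolding c(2) layered_def by (simp add: mem_Times_iff)
  qed
  from card_mono[OF _ this] have "card X \<le> (p - 1) * p"
    by (simp add: card_image[OF inj] nat_diff_distrib')
  moreover have "(p - 1) * p < p\<^sup>2" using p_gt_2 by (simp add: power2_eq_square)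
  moreover have "card X > 0" using assms by (simp add: card_gt_0_iff)
  ultimately show ?thesis by (metis dvd_imp_le leD order.strict_trans1)
qed

lemma id_normalizing: "id \<in> normalizing_isos V t Q Q"
proof -
  have "id \<circ> t = t ^^ 1 \<circ> id" by simp
  then show ?thesis by (auto simp: normalizing_isos_def rel_isos_def permutes_id simp del: One_nat_def funpow.simps intro: exI[of _ "1::nat"])
qed

lemma finite_normalizing_isos:
  "finite (normalizing_isos (layered p) t Q Q' :: (int \<times> 'b::finite \<Rightarrow> int \<times> 'b) set)"
  by (rule finite_subset[OF _ finite_rel_isos[OF finite_layered]]) (auto simp: normalizing_isos_def)

lemma layered_nonempty: "layered p \<noteq> {}"
  using p_gt_2 by (auto simp: layered_def)

section \<open>Isomorphic Cayley digraphs of the cyclic group of order p\<close>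

definition cyc_arc :: "int set \<Rightarrow> int \<times> unit \<Rightarrow> int \<times> unit \<Rightarrow> bool" where
  "cyc_arc A x y \<longleftrightarrow> (fst y - fst x) mod int p \<in> A"

lemma cyc_arc_shift: "shift p \<in> rel_isos (layered p) (cyc_arc A) (cyc_arc A)"
proof -
  have "cyc_arc A (shift p x) (shift p y) \<longleftrightarrow> cyc_arc A x y" if "x \<in> layered p" "y \<in> layered p" for x y
    using that by (simp add: shift_def cyc_arc_def mod_simps)
  then show ?thesis by (simp add: rel_isos_def shift_permutes)
qed

text \<open>With a single layer, slope and image of the origin determine a normalizing automorphism,
  so their number is never a multiple of \<open>p\<^sup>2\<close> and an affine isomorphism exists.
  Its offset cancels in differences and its slope is the multiplier \<open>u\<close>.\<close>

lemma cyclic_iso_imp_multiplier: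
  assumes "f \<in> rel_isos (layered p) (cyc_arc A) (cyc_arc A')"
  obtains u where "\<not> int p dvd u" "\<And>n. n mod int p \<in> A \<longleftrightarrow> (u * n) mod int p \<in> A'"
proof -
  let ?N = "normalizing_isos (layered p) (shift p) (cyc_arc A) (cyc_arc A)"
  have "inj_on (\<lambda>g. (slope p () g, fst (g (0, ())))) ?N"
  proof (rule inj_onI)
    fix g g' assume g: "g \<in> ?N" and g': "g' \<in> ?N"
      and eq: "(slope p () g, fst (g (0, ()))) = (slope p () g', fst (g' (0, ())))"
    obtain c where "\<not> int p dvd c" and c: "\<And>i a. 0 \<le> i \<Longrightarrow> i < int p \<Longrightarrow>
        g (i, a) = ((fst (g (0, a)) + c * i) mod int p, snd (g (0, a)))"
      "\<And>a. slope p a g = c mod int p" using normalizing_iso_affine[OF g] by blast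
    obtain c' where "\<not> int p dvd c'" and c': "\<And>i a. 0 \<le> i \<Longrightarrow> i < int p \<Longrightarrow>
        g' (i, a) = ((fst (g' (0, a)) + c' * i) mod int p, snd (g' (0, a)))"
      "\<And>a. slope p a g' = c' mod int p" using normalizing_iso_affine[OF g'] by blast
    have perm: "g permutes layered p" "g' permutes layered p"
      using g g' by (simp_all add: normalizing_isos_def rel_isos_def)
    have cc: "c mod int p = c' mod int p" using eq c(2) c'(2) by simp
    show "g = g'"
    proof
      fix x :: "int \<times> unit"
      show "g x = g' x"
      proof (cases "x \<in> layered p")
        case True
        then obtain i where x: "x = (i, ())" "0 \<le> i" "i < int p"
          by (cases x) (auto simp: layered_def)
        have "(fst (g (0, ())) + c * i) mod int p = (fst (g (0, ())) + (c mod int p) * i) mod int p"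
          by (simp add: affine_mod_simps)
        also have "\<dots> = (fst (g' (0, ())) + c' * i) mod int p"
          using eq by (simp add: cc affine_mod_simps)
        finally show ?thesis using c(1)[OF x(2,3)] c'(1)[OF x(2,3)] by (simp add: x(1))
      next
        case False
        then show ?thesis using perm by (simp add: permutes_not_in)
      qed
    qed
  qed
  then have "\<not> p\<^sup>2 dvd card ?N"
    by (intro card_normalizing_isos_bound[of _ "cyc_arc A" "cyc_arc A" "()"])
      (use id_normalizing[of "layered p" "shift p" "cyc_arc A"] finite_normalizing_isos in auto)
  then obtain g where g: "g \<in> normalizing_isos (layered p) (shift p) (cyc_arc A) (cyc_arc A')"
    using normalizing_iso_exists[OF prime_p finite_layered layered_nonempty shift_funpow_p shift_neq
        cyc_arc_shift cyc_arc_shift assms] by blast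
  obtain c where nd: "\<not> int p dvd c" and c: "\<And>i a. 0 \<le> i \<Longrightarrow> i < int p \<Longrightarrow>
        g (i, a) = ((fst (g (0, a)) + c * i) mod int p, snd (g (0, a)))"
    and "\<And>a. slope p a g = c mod int p" using normalizing_iso_affine[OF g] by blast
  have "n mod int p \<in> A \<longleftrightarrow> (c * n) mod int p \<in> A'" for n
  proof -
    have arc: "cyc_arc A (0, ()) (n mod int p, ()) \<longleftrightarrow>
        cyc_arc A' (g (0, ())) (g (n mod int p, ()))"
      using g p_gt_2 by (auto simp: normalizing_isos_def rel_isos_def layered_def)
    have "(fst (g (n mod int p, ())) - fst (g (0, ()))) mod int p = (c * n) mod int p"
      using c[of "n mod int p" "()"] by (simp add: mod_simps)
    then show ?thesis using arc by (simp add: cyc_arc_def)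
  qed
  with nd show ?thesis using that by blast
qed

section \<open>Affine isomorphisms between dihedral Cayley digraphs\<close>

lemma permutes_layered_mod:
  assumes "h permutes layered p"
  shows "fst (h (0, a)) mod int p = fst (h (0, a))"
proof -
  have "h (0, a) \<in> layered p"
    using assms p_gt_2 by (simp add: permutes_in_image) (simp add: layered_def)
  then show ?thesis by (simp add: layered_def mem_Times_iff)
qed

text \<open>An affine map with invertible slope fills the layer it maps into, so an injective map
  cannot send both layers to the same one.\<close>

lemma normalizing_iso_layers:
  assumes h: "h \<in> normalizing_isos (layered p) (shift p) Q Q'"
  shows "snd (h (0, True)) \<longleftrightarrow> \<not> snd (h (0, False))"
proof (rule ccontr)
  assume eq: "\<not> ?thesis"
  have perm: "h permutes layered p" using h by (simp add: normalizing_isos_def rel_isos_def)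
  obtain b where nb: "\<not> int p dvd b" and b: "\<And>i a. 0 \<le> i \<Longrightarrow> i < int p \<Longrightarrow>
      h (i, a) = ((fst (h (0, a)) + b * i) mod int p, snd (h (0, a)))"
    and "\<And>a. slope p a h = b mod int p" using normalizing_iso_affine[OF h] by blast
  obtain j where j: "0 \<le> j" "j < int p"
    "(b * j) mod int p = (fst (h (0, True)) - fst (h (0, False))) mod int p"
    using linear_congruence_solution[OF nb] by blast
  have "(fst (h (0, False)) + b * j) mod int p = (fst (h (0, False)) + (b * j) mod int p) mod int p"
    by (simp add: mod_simps)
  also have "\<dots> = fst (h (0, True)) mod int p" by (simp add: j(3) mod_simps)
  also have "\<dots> = fst (h (0, True))" using permutes_layered_mod[OF perm] .
  finally have "h (j, False) = h (0, True)"
    using b[OF j(1,2), of False] eq by (simp add: prod_eq_iff)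
  from injD[OF permutes_inj[OF perm] this] have "(j, False) = (0, True)" .
  then show False by simp
qed

text \<open>Two normalizing automorphisms that agree on one layer differ by a shift of the other, which would make
  the arcs between the layers all present or all absent.\<close>

lemma dih_normalizing_slope_inj:
  assumes nonconst: "\<not> (\<forall>i j. (i mod int p, True) \<in> S \<longleftrightarrow> (j mod int p, True) \<in> S)"
  shows "inj_on (\<lambda>g. (slope p False g, fst (g (0, False))))
    {g \<in> normalizing_isos (layered p) (shift p) (dih_arc p S) (dih_arc p S). \<not> snd (g (0, False))}"
proof (rule inj_onI, clarify)
  fix g g'
  assume g: "g \<in> normalizing_isos (layered p) (shift p) (dih_arc p S) (dih_arc p S)"
    and g': "g' \<in> normalizing_isos (layered p) (shift p) (dih_arc p S) (dih_arc p S)"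
    and F: "\<not> snd (g (0, False))" "\<not> snd (g' (0, False))"
    and sl: "slope p False g = slope p False g'" and eq: "fst (g (0, False)) = fst (g' (0, False))"
  obtain c where nd: "\<not> int p dvd c" and c: "\<And>i a. 0 \<le> i \<Longrightarrow> i < int p \<Longrightarrow>
        g (i, a) = ((fst (g (0, a)) + c * i) mod int p, snd (g (0, a)))"
      "\<And>a. slope p a g = c mod int p" using normalizing_iso_affine[OF g] by blast
  obtain c' where "\<not> int p dvd c'" and c': "\<And>i a. 0 \<le> i \<Longrightarrow> i < int p \<Longrightarrow>
        g' (i, a) = ((fst (g' (0, a)) + c' * i) mod int p, snd (g' (0, a)))"
      "\<And>a. slope p a g' = c' mod int p" using normalizing_iso_affine[OF g'] by blast
  have perm: "g permutes layered p" "g' permutes layered p"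
    using g g' by (simp_all add: normalizing_isos_def rel_isos_def)
  have cc: "c mod int p = c' mod int p" using sl c(2) c'(2) by simp
  have cmul: "(d + c * i) mod int p = (d + c' * i) mod int p" for d i
    by (metis cc mod_add_right_eq mod_mult_left_eq)
  have gT: "snd (g (0, True))" "snd (g' (0, True))" using normalizing_iso_layers[OF g] normalizing_iso_layers[OF g'] F by auto
  \<comment> \<open>On the layer \<open>True\<close> the two maps differ by the shift
    \<open>e\<close>: \<open>g' (j + e, True) = g (j, True)\<close>. Both send the origin of the
    layer \<open>False\<close> to the same point, so the arcs from there to j and to j + e have the
    same image, and membership in \<open>S\<close> is invariant under \<open>e\<close>.\<close>
  obtain e where e: "(c * e) mod int p = (fst (g (0, True)) - fst (g' (0, True))) mod int p"
    using linear_congruence_solution[OF nd] by blast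
  have "int p dvd e"
  proof (rule ccontr)
    assume ne: "\<not> int p dvd e"
    have step: "(j mod int p, True) \<in> S \<longleftrightarrow> ((j + e) mod int p, True) \<in> S" for j
    proof -
      have arc: "dih_arc p S (0, False) (i mod int p, True) \<longleftrightarrow>
          dih_arc p S (h (0, False)) (h (i mod int p, True))"
        if "h \<in> normalizing_isos (layered p) (shift p) (dih_arc p S) (dih_arc p S)" for h i
        using that p_gt_2 by (auto simp: normalizing_isos_def rel_isos_def layered_def)
      have "(fst (g' (0, True)) + c' * ((j + e) mod int p)) mod int p =
          (fst (g' (0, True)) + c * ((j + e) mod int p)) mod int p" by (simp add: cmul)
      also have "\<dots> = (fst (g' (0, True)) + c * j + (c * e) mod int p) mod int p"
        by (simp add: affine_mod_simps mod_simps distrib_left flip: add.assoc)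
      also have "\<dots> = (fst (g (0, True)) + c * (j mod int p)) mod int p"
        unfolding e by (simp only: affine_mod_simps mod_simps) (simp add: algebra_simps)
      finally have "g' ((j + e) mod int p, True) = g (j mod int p, True)"
        using c(1)[of "j mod int p" True] c'(1)[of "(j + e) mod int p" True] gT by simp
      moreover have "g (0, False) = g' (0, False)" using eq F by (simp add: prod_eq_iff)
      ultimately show ?thesis using arc[OF g, of j] arc[OF g', of "j + e"]
        by (simp add: dih_arc_def[of p S "(0, False)"] dih_diff_def)
    qed
    show False using nonconst constant_if_invariant_under_step[OF ne, of "\<lambda>i. (i, True) \<in> S"] step
      by blast
  qed
  then have "int p dvd c * e" by simp
  then have "(fst (g (0, True)) - fst (g' (0, True))) mod int p = 0"
    using e by (simp add: dvd_eq_mod_eq_0)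
  then have "fst (g (0, True)) mod int p = fst (g' (0, True)) mod int p"
    by (simp add: mod_eq_dvd_iff dvd_eq_mod_eq_0)
  moreover have "fst (g (0, a)) mod int p = fst (g (0, a))" "fst (g' (0, a)) mod int p = fst (g' (0, a))" for a
    by (rule permutes_layered_mod[OF perm(1)], rule permutes_layered_mod[OF perm(2)])
  ultimately have eqT: "fst (g (0, True)) = fst (g' (0, True))" by simp
  show "g = g'"
  proof
    fix x
    show "g x = g' x"
    proof (cases "x \<in> layered p")
      case True
      then obtain i a where x: "x = (i, a)" "0 \<le> i" "i < int p"
        by (cases x) (auto simp: layered_def)
      have "g (0, a) = g' (0, a)" using eqT eq F gT by (cases a) (simp_all add: prod_eq_iff)
      then show ?thesis using c(1)[OF x(2,3), of a] c'(1)[OF x(2,3), of a] by (simp add: x(1) cmul)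
    next
      case False
      then show ?thesis using perm by (simp add: permutes_not_in)
    qed
  qed
qed

text \<open>The flip conjugates the shift to its inverse, which is the power p - 1.\<close>

lemma dih_flip_normalizing:
  assumes "g \<in> normalizing_isos (layered p) (shift p) Q (dih_arc p S)"
  shows "dih_flip p \<circ> g \<in> normalizing_isos (layered p) (shift p) Q (dih_arc p S)"
proof -
  obtain c where c: "g \<circ> shift p = shift p ^^ c \<circ> g" and g: "g \<in> rel_isos (layered p) Q (dih_arc p S)"
    using assms by (auto simp: normalizing_isos_def)
  have step: "dih_flip p (shift p x) = (shift p ^^ (p - 1)) (dih_flip p x)" for x
  proof (cases "x \<in> layered p")
    case True
    moreover from True have "dih_flip p x \<in> layered p"
      using dih_flip_permutes by (simp add: permutes_in_image)
    moreover have "(- fst x + int (p - 1)) mod int p = (- fst x - 1) mod int p"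
    proof -
      have "- fst x + int (p - 1) = (- fst x - 1) + int p" using p_gt_2 by (simp add: of_nat_diff)
      then show ?thesis by (simp only: mod_add_self2)
    qed
    ultimately show ?thesis
      by (simp add: funpow_shift) (simp add: dih_flip_def shift_def layered_def mem_Times_iff mod_simps)
  next
    case False
    then have "(shift p ^^ n) x = x" for n by (induction n) (simp_all add: shift_def)
    with False show ?thesis by (simp add: dih_flip_def shift_def)
  qed
  have "dih_flip p ((shift p ^^ n) x) = (shift p ^^ ((p - 1) * n)) (dih_flip p x)" for n x
    by (induction n) (simp_all add: step funpow_add)
  then have "dih_flip p \<circ> g \<circ> shift p = shift p ^^ ((p - 1) * c) \<circ> (dih_flip p \<circ> g)"
    using c by (simp add: fun_eq_iff)
  then show ?thesis using rel_isos_comp[OF g dih_arc_flip] by (auto simp: normalizing_isos_def)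
qed

text \<open>The flip pairs the automorphisms that keep the layers (\<open>N0\<close>) with those
  that swap them (\<open>N1\<close>). The total is twice a number strictly between 0 and
  \<open>p\<^sup>2\<close>, and p is odd.\<close>

lemma dih_normalizing_not_dvd:
  assumes nonconst: "\<not> (\<forall>i j. (i mod int p, True) \<in> S \<longleftrightarrow> (j mod int p, True) \<in> S)"
  shows "\<not> p\<^sup>2 dvd card (normalizing_isos (layered p) (shift p) (dih_arc p S) (dih_arc p S))"
proof -
  let ?N = "normalizing_isos (layered p) (shift p) (dih_arc p S) (dih_arc p S)"
  define N0 where "N0 = {g \<in> ?N. \<not> snd (g (0, False))}"
  define N1 where "N1 = {g \<in> ?N. snd (g (0, False))}"
  have "\<not> p\<^sup>2 dvd card N0"
  proof (rule card_normalizing_isos_bound[of _ "dih_arc p S" "dih_arc p S" False])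
    show "inj_on (\<lambda>g. (slope p False g, fst (g (0, False)))) N0"
      unfolding N0_def by (rule dih_normalizing_slope_inj[OF nonconst])
    show "N0 \<noteq> {}" using id_normalizing by (auto simp: N0_def intro!: exI[of _ id])
  qed (auto simp: N0_def finite_normalizing_isos)
  moreover have "card N1 = card N0"
  proof -
    have "snd (dih_flip p (g (0, False))) \<longleftrightarrow> \<not> snd (g (0, False))" if "g \<in> ?N" for g
    proof -
      have "g permutes layered p" using that by (simp add: normalizing_isos_def rel_isos_def)
      then have "g (0, False) \<in> layered p"
        using p_gt_2 by (simp add: permutes_in_image) (simp add: layered_def)
      then show ?thesis by (simp add: dih_flip_def)
    qed
    then have "bij_betw (\<lambda>g. dih_flip p \<circ> g) N1 N0"
      by (intro bij_betw_byWitness[where f' = "\<lambda>g. dih_flip p \<circ> g"])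
        (auto simp: N0_def N1_def dih_flip_normalizing o_assoc dih_flip_involution)
    then show ?thesis by (rule bij_betw_same_card)
  qed
  moreover have "?N = N0 \<union> N1" "N0 \<inter> N1 = {}" by (auto simp: N0_def N1_def)
  then have "card ?N = card N0 + card N1"
    using finite_normalizing_isos[of "shift p" "dih_arc p S" "dih_arc p S"]
    by (metis card_Un_disjoint finite_Un)
  moreover have "coprime (p\<^sup>2) 2" using odd_p by simp
  ultimately show ?thesis by (simp add: coprime_dvd_mult_right_iff flip: mult_2)
qed

text \<open>The arcs leaving the identity element show \<open>S\<close> itself: \<open>x\<close>
  lies in \<open>S\<close> iff the quotient of \<open>g x\<close> by the image of the identity lies
  in \<open>S'\<close>. Since \<open>g\<close> is affine with one slope on both layers, this
  quotient is a group automorphism applied to \<open>x\<close>.\<close>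

lemma dih_normalizing_iso_imp_aff:
  assumes g: "g \<in> normalizing_isos (layered p) (shift p) (dih_arc p S) (dih_arc p S')"
  shows "\<exists>u v. \<not> int p dvd u \<and> (\<forall>x\<in>layered p. x \<in> S \<longleftrightarrow> dih_aff p u v x \<in> S')"
proof -
  obtain c where nd: "\<not> int p dvd c" and c: "\<And>i a. 0 \<le> i \<Longrightarrow> i < int p \<Longrightarrow>
      g (i, a) = ((fst (g (0, a)) + c * i) mod int p, snd (g (0, a)))"
    and "\<And>a. slope p a g = c mod int p" using normalizing_iso_affine[OF g] by blast
  define d where "d = (\<lambda>a. fst (g (0, a)))"
  define \<pi> where "\<pi> = (\<lambda>a. snd (g (0, a)))"
  have arc: "x \<in> S \<longleftrightarrow> dih_diff p (g (0, False)) (g x) \<in> S'" if "x \<in> layered p" for x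
  proof -
    have "(0, False) \<in> layered p" using p_gt_2 by (simp add: layered_def)
    moreover have "dih_diff p (0, False) x = x" using that
      by (cases x) (simp add: dih_diff_def layered_def)
    ultimately show ?thesis using g that
      unfolding normalizing_isos_def rel_isos_def dih_arc_def by force
  qed
  have aff: "g (i, a) = ((d a + c * i) mod int p, \<pi> a)" if "(i, a) \<in> layered p" for i a
    using that c[of i a] by (simp add: layered_def d_def \<pi>_def)
  have T: "\<pi> True \<longleftrightarrow> \<not> \<pi> False"
    unfolding \<pi>_def by (rule normalizing_iso_layers[OF g])
  have 0: "g (0, False) = (d False, \<pi> False)" by (simp add: d_def \<pi>_def)
  show ?thesis
  proof (cases "\<pi> False")
    case False
    have "dih_diff p (g (0, False)) (g x) = dih_aff p c (d True - d False) x" if "x \<in> layered p" for x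
      using that aff[of "fst x" "snd x"] False T
      by (cases x; cases "snd x") (simp_all add: 0 dih_diff_def dih_aff_def mod_simps algebra_simps)
    with arc nd show ?thesis by (intro exI[of _ c] exI[of _ "d True - d False"]) simp
  next
    case True
    \<comment> \<open>The image of the identity is a reflection, and \<open>dih_diff\<close> changes
      the sign when its source is a reflection.\<close>
    have "dih_diff p (g (0, False)) (g x) = dih_aff p (- c) (d False - d True) x"
      if "x \<in> layered p" for x
      using that aff[of "fst x" "snd x"] True T
      by (cases x; cases "snd x") (simp_all add: 0 dih_diff_def dih_aff_def mod_simps algebra_simps)
    with arc nd show ?thesis
      by (intro exI[of _ "- c"] exI[of _ "d False - d True"]) simp
  qed
qed

lemma dih_aff_closed: "dih_aff p u v x \<in> layered p"
  by (simp add: dih_aff_def layered_def)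

lemma dih_aff_comp: "dih_aff p u v (dih_aff p u' v' x) = dih_aff p (u * u') (u * v' + v) x"
  by (cases "snd x") (simp_all add: dih_aff_def mod_simps affine_mod_simps algebra_simps)

lemma dih_aff_mod: "dih_aff p (u mod int p) (v mod int p) x = dih_aff p u v x"
  by (simp add: dih_aff_def affine_mod_simps mod_simps)

lemma dih_aff_one: "x \<in> layered p \<Longrightarrow> dih_aff p 1 0 x = x"
  by (cases x) (simp add: dih_aff_def layered_def)

lemma dih_aff_inverse:
  assumes "\<not> int p dvd u"
  obtains u' v' where "\<not> int p dvd u'" "\<And>x. x \<in> layered p \<Longrightarrow> dih_aff p u' v' (dih_aff p u v x) = x"
    "\<And>x. x \<in> layered p \<Longrightarrow> dih_aff p u v (dih_aff p u' v' x) = x"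
proof -
  obtain u' where u': "u' * u mod int p = 1" "\<not> int p dvd u'" using modular_inverse assms by blast
  have 1: "1 mod int p = 1" using p_gt_2 by simp
  have "dih_aff p u' (- (u' * v)) (dih_aff p u v x) = x" if "x \<in> layered p" for x
  proof -
    have "dih_aff p u' (- (u' * v)) (dih_aff p u v x) = dih_aff p ((u' * u) mod int p) (0 mod int p) x"
      unfolding dih_aff_mod by (simp add: dih_aff_comp)
    then show ?thesis using that by (simp add: u'(1) dih_aff_one)
  qed
  moreover have "dih_aff p u v (dih_aff p u' (- (u' * v)) x) = x" if "x \<in> layered p" for x
  proof -
    have "(u * - (u' * v) + v) mod int p = (v - (u' * u mod int p) * v) mod int p"
      by (metis (no_types, opaque_lifting) add.commute diff_conv_add_uminus mod_diff_right_eq mod_mult_left_eq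
          mult.assoc mult.commute mult_minus_right)
    also have "\<dots> = 0" by (simp add: u'(1))
    finally have "dih_aff p u v (dih_aff p u' (- (u' * v)) x) =
        dih_aff p ((u' * u) mod int p) (0 mod int p) x"
      using dih_aff_mod[of "u * u'" "u * - (u' * v) + v" x] by (simp add: dih_aff_comp mult.commute)
    then show ?thesis using that by (simp add: u'(1) dih_aff_one)
  qed
  ultimately show ?thesis using that u'(2) by blast
qed

text \<open>Here a pair without an arc lies within one layer. A rotation missing from
  \<open>S\<close> gives non-arcs that join up the whole layer \<open>False\<close>, so
  \<open>f\<close> maps this layer into a single layer. The cyclic case applied to that restriction
  gives a multiplier; the reflections, all present on both sides, impose no further
  condition.\<close>

lemma dih_full_cross_iso_imp_aff:
  assumes S: "S \<subseteq> layered p - {(0, False)}" and S': "S' \<subseteq> layered p - {(0, False)}"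
    and card: "card S = card S'"
    and full: "\<And>i. (i mod int p, True) \<in> S" and full': "\<And>i. (i mod int p, True) \<in> S'"
    and f: "f \<in> rel_isos (layered p) (dih_arc p S) (dih_arc p S')"
  shows "\<exists>u v. \<not> int p dvd u \<and> (\<forall>x\<in>layered p. x \<in> S \<longleftrightarrow> dih_aff p u v x \<in> S')"
proof (cases "S = layered p - {(0, False)}")
  case True
  \<comment> \<open>The complete digraph offers no missing rotation, but equal cardinalities then
    force equal sets.\<close>
  have "S' = S" using card_subset_eq[of S S'] S' card finite_layered True by (simp add: finite_layered)
  moreover have "\<not> int p dvd 1" using p_gt_2 by simp
  ultimately show ?thesis by (intro exI[of _ 1] exI[of _ 0]) (simp add: dih_aff_one)
next
  case False
  then obtain x where x: "x \<in> layered p" "x \<noteq> (0, False)" "x \<notin> S" using S by blast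
  have xF: "\<not> snd x"
  proof
    assume "snd x"
    then have "x = (fst x mod int p, True)" using x by (cases x) (simp add: layered_def)
    then show False using full x by metis
  qed
  define a where "a = fst x"
  have a: "0 \<le> a" "a < int p" "a \<noteq> 0" "(a, False) \<notin> S"
    using x xF by (cases x; simp add: a_def layered_def)+
  have nda: "\<not> int p dvd a" using a(1-3) by (simp add: zdvd_not_zless)
  have perm: "f permutes layered p" using f by (simp add: rel_isos_def)
  have fV: "f x \<in> layered p" if "x \<in> layered p" for x
    using perm that by (simp add: permutes_in_image)
  have V: "(i mod int p, b) \<in> layered p" for i and b :: bool by (simp add: layered_def)
  have arc: "dih_diff p x y \<in> S \<longleftrightarrow> dih_diff p (f x) (f y) \<in> S'"
    if "x \<in> layered p" "y \<in> layered p" for x y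
    using f that by (simp add: rel_isos_def dih_arc_def)
  \<comment> \<open>An arc is missing from i to i + a; if the images lay in different layers,
    \<open>full'\<close> would supply one.\<close>
  have same: "snd (f (i mod int p, False)) \<longleftrightarrow> snd (f ((i + a) mod int p, False))" for i
  proof (rule ccontr)
    assume "\<not> ?thesis"
    then have "dih_diff p (f (i mod int p, False)) (f ((i + a) mod int p, False)) \<in> S'"
      by (simp add: dih_diff_def full')
    moreover have "dih_diff p (i mod int p, False) ((i + a) mod int p, False) = (a, False)"
      using a by (simp add: dih_diff_def mod_simps)
    ultimately show False using arc[OF V V] a(4) by metis
  qed
  define e where "e = snd (f (0, False))"
  have layer: "snd (f (i mod int p, False)) = e" for i
    using constant_if_invariant_under_step[OF nda, of "\<lambda>i. snd (f (i, False))" i 0] same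
    by (simp add: e_def)
  define f0 :: "int \<times> unit \<Rightarrow> int \<times> unit" where
    "f0 x = (if x \<in> layered p then (fst (f (fst x, False)), ()) else x)" for x
  define A where "A = {i. (i, False) \<in> S}"
  \<comment> \<open>If \<open>f\<close> moves the rotations to the reflections (\<open>e\<close>),
    quotients within the image layer carry the opposite sign.\<close>
  define A' where "A' = {i. ((if e then - i else i) mod int p, False) \<in> S'}"
  have lay: "f (i, False) = (fst (f (i, False)), e)" if "0 \<le> i" "i < int p" for i
    using layer[of i] that by (simp add: prod_eq_iff)
  have "f0 permutes layered p"
  proof (rule bij_imp_permutes)
    have "inj_on f0 (layered p)"
    proof (rule inj_onI)
      fix x y assume xy: "x \<in> layered p" "y \<in> layered p" "f0 x = f0 y"
      then have "f (fst x, False) = f (fst y, False)"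
        using lay[of "fst x"] lay[of "fst y"] by (auto simp: f0_def layered_def)
      then have "(fst x, False) = (fst y, False)" using perm by (meson injD permutes_inj)
      then show "x = y" by (simp add: prod_eq_iff)
    qed
    moreover have "f0 ` layered p \<subseteq> layered p"
    proof (rule image_subsetI)
      fix x :: "int \<times> unit" assume "x \<in> layered p"
      then show "f0 x \<in> layered p"
        using fV[of "(fst x, False)"] by (simp add: f0_def layered_def mem_Times_iff)
    qed
    ultimately show "bij_betw f0 (layered p) (layered p)"
      by (simp add: bij_betw_def endo_inj_surj finite_layered)
  qed (simp add: f0_def)
  moreover have "cyc_arc A x y \<longleftrightarrow> cyc_arc A' (f0 x) (f0 y)"
    if xy: "x \<in> layered p" "y \<in> layered p" for x y
  proof -
    obtain i j where ij: "x = (i, ())" "y = (j, ())" "0 \<le> i" "i < int p" "0 \<le> j" "j < int p"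
      using xy by (cases x; cases y) (auto simp: layered_def)
    have "cyc_arc A x y \<longleftrightarrow> dih_diff p (i, False) (j, False) \<in> S"
      by (simp add: cyc_arc_def ij A_def dih_diff_def)
    also have "\<dots> \<longleftrightarrow> dih_diff p (f (i, False)) (f (j, False)) \<in> S'"
      using ij by (intro arc) (simp_all add: layered_def)
    also have "\<dots> \<longleftrightarrow> cyc_arc A' (f0 x) (f0 y)"
      using xy by (subst (1 2) lay) (simp_all add: ij dih_diff_def cyc_arc_def A'_def f0_def mod_simps)
    finally show ?thesis .
  qed
  ultimately have "f0 \<in> rel_isos (layered p) (cyc_arc A) (cyc_arc A')" by (simp add: rel_isos_def)
  then obtain u where u: "\<not> int p dvd u" "\<And>n. n mod int p \<in> A \<longleftrightarrow> (u * n) mod int p \<in> A'"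
    using cyclic_iso_imp_multiplier by blast
  define w where "w = (if e then - u else u)"
  have "x \<in> S \<longleftrightarrow> dih_aff p w 0 x \<in> S'" if "x \<in> layered p" for x
  proof (cases "snd x")
    case True
    then have "x = (fst x mod int p, True)" using that by (cases x) (simp add: layered_def)
    then show ?thesis using full full' True by (metis dih_aff_def)
  next
    case False
    then have "x = (fst x mod int p, False)" using that by (cases x) (simp add: layered_def)
    then have "x \<in> S \<longleftrightarrow> fst x mod int p \<in> A" unfolding A_def by (metis mem_Collect_eq)
    also have "\<dots> \<longleftrightarrow> dih_aff p w 0 x \<in> S'"
      using False by (simp add: u(2) A'_def dih_aff_def w_def mod_simps)
    finally show ?thesis .
  qed
  moreover have "\<not> int p dvd w" using u(1) by (simp add: w_def)
  ultimately show ?thesis by blast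
qed

text \<open>The count modulo \<open>p\<^sup>2\<close> needs only one of the two sets to contain some
  but not all reflections. If neither does, both contain all of them, since each contains at least
  one.\<close>

theorem dih_iso_imp_aff:
  assumes S: "S \<subseteq> layered p - {(0, False)}" and S': "S' \<subseteq> layered p - {(0, False)}"
    and card: "card S = card S'"
    and ne: "\<exists>i. (i, True) \<in> S" and ne': "\<exists>i. (i, True) \<in> S'"
    and f: "f \<in> rel_isos (layered p) (dih_arc p S) (dih_arc p S')"
  shows "\<exists>u v. \<not> int p dvd u \<and> (\<forall>x\<in>layered p. x \<in> S \<longleftrightarrow> dih_aff p u v x \<in> S')"
proof -
  define const where
    "const T \<longleftrightarrow> (\<forall>i j. (i mod int p, True) \<in> T \<longleftrightarrow> (j mod int p, True) \<in> T)" for T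
  have ex: "\<exists>u v. \<not> int p dvd u \<and> (\<forall>x\<in>layered p. x \<in> T \<longleftrightarrow> dih_aff p u v x \<in> T')"
    if T: "\<not> const T" and h: "h \<in> rel_isos (layered p) (dih_arc p T) (dih_arc p T')" for T T' h
  proof -
    obtain g where "g \<in> normalizing_isos (layered p) (shift p) (dih_arc p T) (dih_arc p T')"
      using normalizing_iso_exists[OF prime_p finite_layered layered_nonempty shift_funpow_p shift_neq
          dih_arc_shift dih_arc_shift h dih_normalizing_not_dvd] T
      unfolding const_def by blast
    then show ?thesis by (rule dih_normalizing_iso_imp_aff)
  qed
  have full: "(i mod int p, True) \<in> T" if "T \<subseteq> layered p - {(0, False)}" "\<exists>i. (i, True) \<in> T" "const T" for T i
  proof -
    obtain j where "(j, True) \<in> T" using \<open>\<exists>i. (i, True) \<in> T\<close> by blast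
    moreover from this have "j mod int p = j" using that(1) by (auto simp: layered_def)
    ultimately show ?thesis using \<open>const T\<close> unfolding const_def by metis
  qed
  consider "\<not> const S" | "\<not> const S'" | "const S" "const S'" by blast
  then show ?thesis
  proof cases
    case 1
    then show ?thesis using ex f by blast
  next
    \<comment> \<open>The count is applied to \<open>S'\<close> and the inverse isomorphism; the
      resulting affine map is then inverted.\<close>
    case 2
    then obtain u v where u: "\<not> int p dvd u" and uv: "\<forall>x\<in>layered p. x \<in> S' \<longleftrightarrow> dih_aff p u v x \<in> S"
      using ex[OF _ rel_isos_inv[OF f]] by blast
    obtain u' v' where u': "\<not> int p dvd u'"
      "\<And>x. x \<in> layered p \<Longrightarrow> dih_aff p u v (dih_aff p u' v' x) = x"
      using dih_aff_inverse[OF u] by metis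
    then have "\<forall>x\<in>layered p. x \<in> S \<longleftrightarrow> dih_aff p u' v' x \<in> S'"
      using uv dih_aff_closed by metis
    with u' show ?thesis by blast
  next
    case 3
    then show ?thesis
      using dih_full_cross_iso_imp_aff[OF S S' card full[OF S ne] full[OF S' ne'] f] by blast
  qed
qed

end

section \<open>The presented dihedral group and its Cayley digraphs\<close>

text \<open>The product of \<open>\<sigma>\<^sup>a \<tau>\<^sup>i\<close> and
  \<open>\<sigma>\<^sup>b \<tau>\<^sup>j\<close>, from
  \<open>\<tau>\<^sup>i \<sigma> = \<sigma> \<tau>\<^sup>-\<^sup>i\<close>.\<close>

definition dih_mult :: "nat \<Rightarrow> int \<times> bool \<Rightarrow> int \<times> bool \<Rightarrow> int \<times> bool" where
  "dih_mult p x y = ((if snd y then fst y - fst x else fst y + fst x) mod int p, snd x \<noteq> snd y)"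

text \<open>The value -1 may stay unreduced: \<open>dih_mult\<close> reduces modulo p and
  \<open>rep\<close> takes integer powers.\<close>

fun dih_letter :: "dihedral_gen \<times> bool \<Rightarrow> int \<times> bool" where
  "dih_letter (Tau, b) = (if b then 1 else - 1, False)"
| "dih_letter (Sigma, b) = (0, True)"

text \<open>Evaluation in the concrete model on pairs. It respects the relations and so tells
  classes of words apart.\<close>

fun dih_eval :: "nat \<Rightarrow> dihedral_gen group_word \<Rightarrow> int \<times> bool" where
  "dih_eval p [] = (0, False)"
| "dih_eval p (l # w) = dih_mult p (dih_letter l) (dih_eval p w)"

definition dih_word :: "int \<times> bool \<Rightarrow> dihedral_gen group_word" where
  "dih_word x = (if snd x then [(Sigma, True)] else []) @ replicate (nat (fst x)) (Tau, True)"

definition dih_class :: "nat \<Rightarrow> int \<times> bool \<Rightarrow> dihedral_gen group_word set" where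
  "dih_class p x = word_cong (dihedral_rels p) `` {dih_word x}"

text \<open>In every group the relations alone bring products to the form
  \<open>s\<^sup>a t\<^sup>i\<close> with \<open>i\<close> modulo p. This bounds the presented group
  from above; the evaluation of words bounds it from below.\<close>

locale dihedral_relations = group G for G (structure) +
  fixes p :: nat and s t
  assumes s: "s \<in> carrier G" and t: "t \<in> carrier G"
    and t_pow: "t [^] p = \<one>" and s_sq: "s \<otimes> s = \<one>" and conj: "s \<otimes> t \<otimes> s = inv t"
begin

definition rep :: "int \<times> bool \<Rightarrow> 'a" where
  "rep x = (if snd x then s else \<one>) \<otimes> t [^] fst x"

lemma rep_closed [simp]: "rep x \<in> carrier G"
  using s t by (simp add: rep_def)

lemma pow_mod: "t [^] (i mod int p) = t [^] (i :: int)"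
proof -
  have "t [^] i = t [^] (int p * (i div int p) + i mod int p)" by simp
  also have "\<dots> = (t [^] int p) [^] (i div int p) \<otimes> t [^] (i mod int p)"
    using t by (simp only: int_pow_mult int_pow_pow)
  also have "\<dots> = t [^] (i mod int p)"
    using t t_pow by (simp add: int_pow_int int_pow_one)
  finally show ?thesis by simp
qed

lemma t_s: "t \<otimes> s = s \<otimes> inv t"
proof -
  have "s \<otimes> (s \<otimes> t \<otimes> s) = t \<otimes> s" using s t s_sq by (metis m_assoc m_closed l_one)
  then show ?thesis by (simp add: conj)
qed

lemma pow_s_nat: "t [^] (n :: nat) \<otimes> s = s \<otimes> inv (t [^] n)"
proof (induction n)
  case 0
  then show ?case using s by simp
next
  case (Suc n)
  have "t [^] Suc n \<otimes> s = t [^] n \<otimes> (t \<otimes> s)" using s t by (simp add: m_assoc)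
  also have "\<dots> = t [^] n \<otimes> s \<otimes> inv t" using s t by (simp add: t_s m_assoc)
  also have "\<dots> = s \<otimes> (inv (t [^] n) \<otimes> inv t)" using s t by (simp add: Suc m_assoc)
  also have "inv (t [^] n) \<otimes> inv t = inv (t [^] Suc n)"
    using t by (metis inv_mult_group nat_pow_Suc2 nat_pow_Suc nat_pow_closed)
  finally show ?case .
qed

lemma pow_s: "t [^] (i :: int) \<otimes> s = s \<otimes> t [^] (- i)"
proof -
  have nat: "t [^] (int n) \<otimes> s = s \<otimes> t [^] (- int n)" for n
    using pow_s_nat[of n] t by (simp add: int_pow_int int_pow_neg)
  show ?thesis
  proof (cases "i \<ge> 0")
    case True
    then show ?thesis using nat[of "nat i"] by simp
  next
    case False
    define n where "n = nat (- i)"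
    have i: "i = - int n" using False by (simp add: n_def)
    \<comment> \<open>For a negative exponent the identity for \<open>n\<close> is multiplied by
      \<open>t [^] i\<close> on the left and solved for \<open>t [^] i \<otimes> s\<close>.\<close>
    have "t [^] i \<otimes> s \<otimes> t [^] i = t [^] i \<otimes> (t [^] int n \<otimes> s)"
      using nat[of n] s t by (simp add: i m_assoc)
    also have "\<dots> = s" using s t by (simp add: i flip: m_assoc int_pow_mult)
    finally have "t [^] i \<otimes> s \<otimes> t [^] i \<otimes> t [^] (- i) = s \<otimes> t [^] (- i)" by simp
    then show ?thesis using s t by (simp add: m_assoc flip: int_pow_mult)
  qed
qed

lemma rep_mult: "rep x \<otimes> rep y = rep (dih_mult p x y)"
proof (cases "snd y")
  case True
  have "rep x \<otimes> rep y = (if snd x then s else \<one>) \<otimes> ((t [^] fst x \<otimes> s) \<otimes> t [^] fst y)"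
    using s t True by (simp add: rep_def m_assoc)
  also have "\<dots> = (if snd x then s else \<one>) \<otimes> s \<otimes> t [^] (fst y - fst x)"
    using s t by (simp add: pow_s m_assoc flip: int_pow_mult)
  also have "(if snd x then s else \<one>) \<otimes> s = (if snd x \<noteq> snd y then s else \<one>)"
    using s True by (simp add: s_sq)
  finally show ?thesis using True by (simp add: rep_def dih_mult_def pow_mod)
next
  case False
  then show ?thesis using s t
    by (simp add: rep_def dih_mult_def pow_mod m_assoc add.commute flip: int_pow_mult)
qed

end

context odd_prime
begin

abbreviation "D \<equiv> dihedral_group p"

lemma dih_mult_closed: "dih_mult p x y \<in> layered p"
  by (simp add: dih_mult_def layered_def)

lemma dih_mult_assoc: "dih_mult p (dih_mult p x y) z = dih_mult p x (dih_mult p y z)"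
  by (cases "snd x"; cases "snd y"; cases "snd z") (simp_all add: dih_mult_def mod_simps algebra_simps)

lemma dih_mult_one_left: "x \<in> layered p \<Longrightarrow> dih_mult p (0, False) x = x"
  by (cases x) (simp add: dih_mult_def layered_def)

lemma dih_mult_diff: "y \<in> layered p \<Longrightarrow> dih_mult p (dih_diff p x y) x = y"
  by (cases y; cases "snd x"; cases "snd y") (auto simp: dih_mult_def dih_diff_def layered_def mod_simps)

lemma dih_eval_closed: "dih_eval p w \<in> layered p"
  using p_gt_2 by (induction w) (simp_all add: dih_mult_closed, simp add: layered_def)

lemma dih_eval_append: "dih_eval p (u @ v) = dih_mult p (dih_eval p u) (dih_eval p v)"
  by (induction u) (simp_all add: dih_mult_one_left dih_eval_closed dih_mult_assoc)

lemma dih_eval_replicate: "dih_eval p (replicate n (Tau, True)) = (int n mod int p, False)"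
  by (induction n) (simp_all add: dih_mult_def mod_simps add.commute)

lemma dih_eval_cong:
  assumes "(u, v) \<in> word_cong (dihedral_rels p)"
  shows "dih_eval p u = dih_eval p v"
  using assms
proof induction
  case (rel u v)
  then show ?case
    by (auto simp: dihedral_rels_def dih_eval_replicate numeral_2_eq_2 dih_mult_def mod_simps)
next
  case (cancel x b)
  show ?case by (cases x; cases b) (simp_all add: dih_mult_def mod_simps)
qed (simp_all add: dih_eval_append)

lemma dih_eval_word: "x \<in> layered p \<Longrightarrow> dih_eval p (dih_word x) = x"
  by (cases x) (auto simp: dih_word_def dih_eval_append dih_eval_replicate layered_def dih_mult_def)

text \<open>Evaluation is constant on classes and recovers \<open>x\<close> from
  \<open>dih_word x\<close>, so the presented group does not collapse.\<close>

lemma dih_class_inj: "inj_on (dih_class p) (layered p)"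
proof (rule inj_onI)
  fix x y assume xy: "x \<in> layered p" "y \<in> layered p" and "dih_class p x = dih_class p y"
  then have "(dih_word x, dih_word y) \<in> word_cong (dihedral_rels p)"
    using eq_equiv_class[OF _ equiv_word_cong] by (simp add: dih_class_def)
  then show "x = y" using dih_eval_cong dih_eval_word xy by metis
qed

sublocale D: dihedral_relations D p
  "word_cong (dihedral_rels p) `` {[(Sigma, True)]}" "word_cong (dihedral_rels p) `` {[(Tau, True)]}"
proof -
  let ?c = "\<lambda>w. word_cong (dihedral_rels p) `` {w}"
  interpret G: group D unfolding dihedral_group_def by (rule group_presented_group)
  have car: "?c w \<in> carrier D" for w
    by (auto simp: dihedral_group_def presented_group_def quotient_def)
  have mult: "?c u \<otimes>\<^bsub>D\<^esub> ?c v = ?c (u @ v)" for u v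
    unfolding dihedral_group_def by (rule presented_group_mult)
  have one: "\<one>\<^bsub>D\<^esub> = ?c []" by (simp add: dihedral_group_def presented_group_def)
  have eq: "?c u = ?c v" if "(u, v) \<in> dihedral_rels p" for u v
    using equiv_class_eq[OF equiv_word_cong word_cong.rel[OF that]] .
  have pow: "?c [(Tau, True)] [^]\<^bsub>D\<^esub> n = ?c (replicate n (Tau, True))" for n :: nat
    by (induction n) (simp_all add: one mult replicate_append_same)
  have inv: "inv\<^bsub>D\<^esub> ?c [(Tau, True)] = ?c [(Tau, False)]"
  proof (rule G.inv_equality)
    have "([(Tau, False), (Tau, True)], []) \<in> word_cong (dihedral_rels p)"
      using word_cong.cancel[of Tau False] by simp
    then show "?c [(Tau, False)] \<otimes>\<^bsub>D\<^esub> ?c [(Tau, True)] = \<one>\<^bsub>D\<^esub>"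
      by (simp add: mult one equiv_class_eq[OF equiv_word_cong])
  qed (rule car)+
  show "dihedral_relations D p (?c [(Sigma, True)]) (?c [(Tau, True)])"
  proof unfold_locales
    show "?c [(Tau, True)] [^]\<^bsub>D\<^esub> p = \<one>\<^bsub>D\<^esub>"
      unfolding pow one by (rule eq) (simp add: dihedral_rels_def)
    show "?c [(Sigma, True)] \<otimes>\<^bsub>D\<^esub> ?c [(Sigma, True)] = \<one>\<^bsub>D\<^esub>"
      unfolding mult one by (rule eq) (simp add: dihedral_rels_def numeral_2_eq_2)
    show "?c [(Sigma, True)] \<otimes>\<^bsub>D\<^esub> ?c [(Tau, True)] \<otimes>\<^bsub>D\<^esub> ?c [(Sigma, True)] = inv\<^bsub>D\<^esub> ?c [(Tau, True)]"
      unfolding mult inv by (rule eq) (simp add: dihedral_rels_def)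
  qed (rule car)+
qed

lemma class_mult: "word_cong (dihedral_rels p) `` {u @ v} =
    word_cong (dihedral_rels p) `` {u} \<otimes>\<^bsub>D\<^esub> word_cong (dihedral_rels p) `` {v}"
  unfolding dihedral_group_def by (rule presented_group_mult[symmetric])

lemma class_one: "word_cong (dihedral_rels p) `` {[]} = \<one>\<^bsub>D\<^esub>"
  by (simp add: dihedral_group_def presented_group_def)

lemma rep_one: "D.rep (0, False) = \<one>\<^bsub>D\<^esub>"
  by (simp add: D.rep_def)

lemma class_letter: "word_cong (dihedral_rels p) `` {[l]} = D.rep (dih_letter l)"
proof -
  let ?c = "\<lambda>w. word_cong (dihedral_rels p) `` {w}"
  have car: "?c w \<in> carrier D" for w
    by (auto simp: dihedral_group_def presented_group_def quotient_def)
  have inv: "?c [(x, False)] = inv\<^bsub>D\<^esub> ?c [(x, True)]" for x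
  proof (rule D.inv_equality[symmetric])
    have "([(x, False), (x, True)], []) \<in> word_cong (dihedral_rels p)"
      using word_cong.cancel[of x False] by simp
    then show "?c [(x, False)] \<otimes>\<^bsub>D\<^esub> ?c [(x, True)] = \<one>\<^bsub>D\<^esub>"
      by (simp add: equiv_class_eq[OF equiv_word_cong] flip: class_mult class_one)
  qed (rule car)+
  have sinv: "inv\<^bsub>D\<^esub> ?c [(Sigma, True)] = ?c [(Sigma, True)]"
    by (rule D.inv_equality[OF D.s_sq]) (rule car)+
  obtain x b where l: "l = (x, b)" by force
  show ?thesis
    by (cases x; cases b) (simp_all add: l inv sinv D.rep_def car D.int_pow_neg)
qed

text \<open>Every word reduces to normal form, letter by letter through \<open>D.rep_mult\<close>;
  hence \<open>D.rep\<close> is onto the carrier.\<close>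

lemma class_eq_rep_eval: "word_cong (dihedral_rels p) `` {w} = D.rep (dih_eval p w)"
proof (induction w)
  case Nil
  then show ?case by (simp add: class_one rep_one)
next
  case (Cons l w)
  have "word_cong (dihedral_rels p) `` {l # w} = D.rep (dih_letter l) \<otimes>\<^bsub>D\<^esub> D.rep (dih_eval p w)"
    using class_mult[of "[l]" w] arg_cong2[OF class_letter Cons.IH, of "(\<otimes>\<^bsub>D\<^esub>)"]
    by (metis append_Cons append_Nil)
  then show ?case by (simp add: D.rep_mult)
qed

lemma rep_eq_class: "x \<in> layered p \<Longrightarrow> D.rep x = dih_class p x"
  using class_eq_rep_eval[of "dih_word x"] by (simp only: dih_class_def dih_eval_word)

lemma rep_bij: "bij_betw D.rep (layered p) (carrier D)"
proof -
  have "inj_on D.rep (layered p)"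
    using dih_class_inj inj_on_cong[of "layered p" D.rep "dih_class p"] rep_eq_class by blast
  moreover have "A \<in> D.rep ` layered p" if A: "A \<in> carrier D" for A
  proof -
    obtain w where "A = word_cong (dihedral_rels p) `` {w}"
      using A by (auto simp: dihedral_group_def presented_group_def quotient_def)
    then show ?thesis using class_eq_rep_eval dih_eval_closed by blast
  qed
  ultimately show ?thesis by (auto simp: bij_betw_def)
qed

lemma rep_diff:
  assumes "x \<in> layered p" "y \<in> layered p"
  shows "D.rep y \<otimes>\<^bsub>D\<^esub> inv\<^bsub>D\<^esub> D.rep x = D.rep (dih_diff p x y)"
proof -
  have "D.rep (dih_diff p x y) \<otimes>\<^bsub>D\<^esub> D.rep x = D.rep y"
    using assms by (simp add: D.rep_mult dih_mult_diff)
  then show ?thesis by (metis D.inv_solve_right D.rep_closed)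
qed

end

section \<open>Isomorphism, connectedness and out-degree for digraphs whose arcs are vertex
  pairs\<close>

text \<open>An arc is the pair of its ends, and equality with the target digraph forces the new tail
  and head maps to be \<open>fst\<close> and \<open>snd\<close>. So the vertex map alone determines
  the map on arcs.\<close>

lemma digraph_iso_with_proj_iff:
  assumes wf: "parcs P \<subseteq> pverts P \<times> pverts P"
  shows "digraph_iso (with_proj P) (with_proj P') \<longleftrightarrow>
    (\<exists>\<phi>. inj_on \<phi> (pverts P) \<and> pverts P' = \<phi> ` pverts P \<and> parcs P' = map_prod \<phi> \<phi> ` parcs P)"
proof
  assume "digraph_iso (with_proj P) (with_proj P')"
  then obtain hom where hom: "pre_digraph.digraph_isomorphism (with_proj P) hom"
    and eq: "with_proj P' = app_iso hom (with_proj P)"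
    by (auto simp: digraph_iso_def)
  let ?\<phi> = "iso_verts hom"
  have tail: "iso_tail hom = fst" using arg_cong[OF eq, of tail] by simp
  have head: "iso_head hom = snd" using arg_cong[OF eq, of head] by simp
  have inj: "inj_on ?\<phi> (pverts P)"
    using hom by (simp add: pre_digraph.digraph_isomorphism_def)
  have arcs: "iso_arcs hom a = map_prod ?\<phi> ?\<phi> a" if "a \<in> parcs P" for a
    using hom that by (simp add: pre_digraph.digraph_isomorphism_def tail head prod_eq_iff)
  have "pverts P' = ?\<phi> ` pverts P" using arg_cong[OF eq, of verts] by simp
  moreover have "parcs P' = map_prod ?\<phi> ?\<phi> ` parcs P"
    using arg_cong[OF eq, of arcs] arcs by (simp cong: image_cong)
  ultimately show "\<exists>\<phi>. inj_on \<phi> (pverts P) \<and> pverts P' = \<phi> ` pverts P \<and>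
      parcs P' = map_prod \<phi> \<phi> ` parcs P" using inj by blast
next
  assume "\<exists>\<phi>. inj_on \<phi> (pverts P) \<and> pverts P' = \<phi> ` pverts P \<and> parcs P' = map_prod \<phi> \<phi> ` parcs P"
  then obtain \<phi> where \<phi>: "inj_on \<phi> (pverts P)" "pverts P' = \<phi> ` pverts P"
    "parcs P' = map_prod \<phi> \<phi> ` parcs P" by blast
  define hom where "hom = \<lparr> iso_verts = \<phi>, iso_arcs = map_prod \<phi> \<phi>, iso_head = snd, iso_tail = fst \<rparr>"
  have "inj_on (map_prod \<phi> \<phi>) (parcs P)"
    by (rule inj_on_subset[OF map_prod_inj_on[OF \<phi>(1) \<phi>(1)] wf])
  moreover have "wf_digraph (with_proj P)" using wf by unfold_locales auto
  ultimately have "pre_digraph.digraph_isomorphism (with_proj P) hom"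
    using \<phi>(1) by (simp add: pre_digraph.digraph_isomorphism_def hom_def)
  moreover have "with_proj P' = app_iso hom (with_proj P)"
    using \<phi> by (simp add: app_iso_def with_proj_def hom_def)
  ultimately show "digraph_iso (with_proj P) (with_proj P')" unfolding digraph_iso_def by blast
qed

text \<open>The vertices reachable from u, ignoring directions, form a set that no arc leaves or
  enters, and conversely reachability never escapes such a set. This form avoids paths in the
  analysis of Cayley digraphs.\<close>

lemma connected_with_proj_iff:
  assumes wf: "parcs P \<subseteq> pverts P \<times> pverts P"
  shows "Digraph_Component.connected (with_proj P) \<longleftrightarrow> pverts P \<noteq> {} \<and>
    (\<forall>C \<subseteq> pverts P. C \<noteq> {} \<longrightarrow> (\<forall>(x, y) \<in> parcs P. x \<in> C \<longleftrightarrow> y \<in> C) \<longrightarrow> C = pverts P)"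
    (is "?conn \<longleftrightarrow> _ \<and> ?closed")
proof -
  let ?R = "rtrancl_on (pverts P) ((parcs P)\<^sup>s)"
  have conn: "?conn \<longleftrightarrow> pverts P \<noteq> {} \<and> (\<forall>u\<in>pverts P. \<forall>v\<in>pverts P. (u, v) \<in> ?R)"
    by (simp add: connected_conv)
  have closed: "?closed" if R: "\<forall>u\<in>pverts P. \<forall>v\<in>pverts P. (u, v) \<in> ?R"
  proof (intro allI impI)
    fix C assume C: "C \<subseteq> pverts P" "C \<noteq> {}" "\<forall>(x, y) \<in> parcs P. x \<in> C \<longleftrightarrow> y \<in> C"
    then obtain u where u: "u \<in> C" by blast
    have "v \<in> C" if "(u, v) \<in> ?R" for v
      using that by (induction rule: rtrancl_on_induct) (use u C(3) in \<open>auto simp: symcl_def\<close>)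
    then show "C = pverts P" using R C(1) u by blast
  qed
  have reach: "(u, v) \<in> ?R" if cl: ?closed and uv: "u \<in> pverts P" "v \<in> pverts P" for u v
  proof -
    define C where "C = {v. (u, v) \<in> ?R}"
    have "y \<in> C" if "x \<in> C" "(x, y) \<in> parcs P \<or> (y, x) \<in> parcs P" for x y
      using that wf unfolding C_def
      by (auto intro!: rtrancl_on_into_rtrancl_on[of u x] simp: symcl_def image_iff)
    then have "\<forall>(x, y) \<in> parcs P. x \<in> C \<longleftrightarrow> y \<in> C" by blast
    moreover have "C \<subseteq> pverts P" by (auto simp: C_def dest: in_rtrancl_on_in_F)
    moreover have "u \<in> C" using uv by (simp add: C_def)
    ultimately have "C = pverts P" using cl by blast
    then show ?thesis using uv(2) unfolding C_def by blast
  qed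
  show ?thesis
    unfolding conn
  proof (intro conj_cong HOL.refl iffI ballI)
    assume "\<forall>u\<in>pverts P. \<forall>v\<in>pverts P. (u, v) \<in> ?R"
    then show ?closed by (rule closed)
  next
    fix u v assume "?closed" "u \<in> pverts P" "v \<in> pverts P"
    then show "(u, v) \<in> ?R" by (rule reach)
  qed
qed

lemma (in group) out_degree_Cay:
  assumes S: "S \<subseteq> carrier G" and g: "g \<in> carrier G"
  shows "out_degree (Cay G S) g = card S"
proof -
  have "out_arcs (Cay G S) g = (\<lambda>s. (g, s \<otimes> g)) ` S"
  proof
    show "out_arcs (Cay G S) g \<subseteq> (\<lambda>s. (g, s \<otimes> g)) ` S"
    proof
      fix a assume "a \<in> out_arcs (Cay G S) g"
      then obtain h where a: "a = (g, h)" "h \<in> carrier G" "h \<otimes> inv g \<in> S"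
        by (auto simp: out_arcs_def Cay_def)
      then show "a \<in> (\<lambda>s. (g, s \<otimes> g)) ` S"
        using g by (intro image_eqI[of _ _ "h \<otimes> inv g"]) (simp_all add: m_assoc)
    qed
    show "(\<lambda>s. (g, s \<otimes> g)) ` S \<subseteq> out_arcs (Cay G S) g"
      using S g by (auto simp: out_arcs_def Cay_def m_assoc)
  qed
  moreover have "inj_on (\<lambda>s. (g, s \<otimes> g)) S" using S g by (auto intro!: inj_onI simp: subset_iff)
  ultimately show ?thesis by (simp add: out_degree_def card_image)
qed

text \<open>Elements with the same image under \<open>F\<close> are related by \<open>r\<close>, so
  \<open>F\<close> induces a bijection of classes. It serves to replace Cayley digraphs by their
  connection sets.\<close>

lemma card_quotient_image:
  assumes r: "equiv P r" and s: "s \<subseteq> F ` P \<times> F ` P"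
    and rs: "\<And>x y. x \<in> P \<Longrightarrow> y \<in> P \<Longrightarrow> (x, y) \<in> r \<longleftrightarrow> (F x, F y) \<in> s"
  shows "card ((F ` P) // s) = card (P // r)"
proof -
  have sub: "r \<subseteq> P \<times> P" using r by (simp add: equiv_def)
  have cls: "s `` {F x} = F ` (r `` {x})" if "x \<in> P" for x
    using that s sub rs by auto
  have "(F ` P) // s = (\<lambda>C. F ` C) ` (P // r)"
    by (auto simp: quotient_def cls)
  moreover have "inj_on (\<lambda>C. F ` C) (P // r)"
  proof (rule inj_onI)
    fix C C' assume C: "C \<in> P // r" "C' \<in> P // r" and eq: "F ` C = F ` C'"
    obtain x where x: "x \<in> P" "C = r `` {x}" using C(1) by (rule quotientE)
    obtain y where y: "y \<in> P" "C' = r `` {y}" using C(2) by (rule quotientE)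
    have "F y \<in> F ` C'" using y equiv_class_self[OF r] by blast
    then have "(F x, F y) \<in> s" using eq cls[OF x(1)] x(2) by auto
    then have "(x, y) \<in> r" using rs x y by blast
    then show "C = C'" using x y equiv_class_eq[OF r] by blast
  qed
  ultimately show ?thesis by (simp add: card_image)
qed

section \<open>Cayley digraphs of the dihedral group in coordinates\<close>

context odd_prime
begin

abbreviation "dih_Cay S \<equiv> Cay D (D.rep ` S)"

lemma dih_diff_closed: "dih_diff p x y \<in> layered p"
  by (simp add: dih_diff_def layered_def)

lemma rep_in_image_iff:
  assumes "S \<subseteq> layered p" "x \<in> layered p"
  shows "D.rep x \<in> D.rep ` S \<longleftrightarrow> x \<in> S"
  using assms bij_betw_imp_inj_on[OF rep_bij] inj_on_image_mem_iff by metis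

definition dih_pair where
  "dih_pair S = \<lparr> pverts = carrier D,
    parcs = {(g, h). g \<in> carrier D \<and> h \<in> carrier D \<and> h \<otimes>\<^bsub>D\<^esub> inv\<^bsub>D\<^esub> g \<in> D.rep ` S} \<rparr>"

lemma dih_Cay_eq: "dih_Cay S = with_proj (dih_pair S)"
  by (simp add: Cay_def dih_pair_def)

lemma dih_pair_wf: "parcs (dih_pair S) \<subseteq> pverts (dih_pair S) \<times> pverts (dih_pair S)"
  by (auto simp: dih_pair_def)

lemma pverts_dih_pair: "pverts (dih_pair S) = D.rep ` layered p"
  using rep_bij by (simp add: dih_pair_def bij_betw_def)

lemma parcs_dih_pair_iff:
  assumes "S \<subseteq> layered p" "x \<in> layered p" "y \<in> layered p"
  shows "(D.rep x, D.rep y) \<in> parcs (dih_pair S) \<longleftrightarrow> dih_arc p S x y"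
  using assms by (simp add: dih_pair_def rep_diff rep_in_image_iff dih_diff_closed dih_arc_def)

lemma parcs_dih_pair:
  assumes "S \<subseteq> layered p"
  shows "parcs (dih_pair S) = map_prod D.rep D.rep ` {(x, y). x \<in> layered p \<and> y \<in> layered p \<and> dih_arc p S x y}"
proof -
  have "(g, h) \<in> map_prod D.rep D.rep ` {(x, y). x \<in> layered p \<and> y \<in> layered p \<and> dih_arc p S x y}"
    if "(g, h) \<in> parcs (dih_pair S)" for g h
  proof -
    have "g \<in> D.rep ` layered p" "h \<in> D.rep ` layered p"
      using dih_pair_wf that pverts_dih_pair by blast+
    then obtain x y where "g = D.rep x" "x \<in> layered p" "h = D.rep y" "y \<in> layered p" by blast
    with that show ?thesis using parcs_dih_pair_iff[OF assms] by (intro image_eqI[of _ _ "(x, y)"]) auto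
  qed
  moreover have "(D.rep x, D.rep y) \<in> parcs (dih_pair S)"
    if "x \<in> layered p" "y \<in> layered p" "dih_arc p S x y" for x y
    using parcs_dih_pair_iff[OF assms] that by blast
  ultimately show ?thesis by auto
qed

text \<open>Conjugation with the bijection \<open>D.rep\<close> turns vertex maps into permutations
  of the pairs, continued by the identity outside.\<close>

lemma dih_Cay_iso_iff:
  assumes S: "S \<subseteq> layered p" and S': "S' \<subseteq> layered p"
  shows "digraph_iso (dih_Cay S) (dih_Cay S') \<longleftrightarrow>
    rel_isos (layered p) (dih_arc p S) (dih_arc p S') \<noteq> {}"
proof -
  let ?V = "layered p :: (int \<times> bool) set"
  let ?inv = "inv_into ?V D.rep"
  have inj: "inj_on D.rep ?V" using rep_bij by (rule bij_betw_imp_inj_on)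
  have rinv: "?inv (D.rep x) = x" if "x \<in> ?V" for x using inj that by simp
  have vert_map: "rel_isos ?V (dih_arc p S) (dih_arc p S') \<noteq> {}"
    if \<phi>: "inj_on \<phi> (D.rep ` ?V)" "D.rep ` ?V = \<phi> ` D.rep ` ?V"
      "parcs (dih_pair S') = map_prod \<phi> \<phi> ` parcs (dih_pair S)" for \<phi>
  proof -
    define f where "f x = (if x \<in> ?V then ?inv (\<phi> (D.rep x)) else x)" for x
    have im: "\<phi> (D.rep x) \<in> D.rep ` ?V" if "x \<in> ?V" for x
      using that \<phi>(2) by blast
    have repf: "D.rep (f x) = \<phi> (D.rep x)" if "x \<in> ?V" for x
      using that f_inv_into_f[OF im[OF that]] by (simp only: f_def if_True)
    have fV: "f x \<in> ?V" if "x \<in> ?V" for x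
      using that inv_into_into[OF im[OF that]] by (simp only: f_def if_True)
    have "inj_on f ?V"
    proof (rule inj_onI)
      fix x y assume xy: "x \<in> ?V" "y \<in> ?V" "f x = f y"
      then have "\<phi> (D.rep x) = \<phi> (D.rep y)" using repf by metis
      then have "D.rep x = D.rep y" by (rule inj_onD[OF \<phi>(1)]) (use xy in simp_all)
      then show "x = y" by (rule inj_onD[OF inj]) (use xy in simp_all)
    qed
    moreover have "f ` ?V \<subseteq> ?V" using fV by blast
    ultimately have perm: "f permutes ?V"
      by (intro bij_imp_permutes) (simp_all add: bij_betw_def endo_inj_surj finite_layered, simp add: f_def)
    have "dih_arc p S x y \<longleftrightarrow> dih_arc p S' (f x) (f y)" if xy: "x \<in> ?V" "y \<in> ?V" for x y
    proof -
      have "dih_arc p S' (f x) (f y) \<longleftrightarrow> (\<phi> (D.rep x), \<phi> (D.rep y)) \<in> parcs (dih_pair S')"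
        using parcs_dih_pair_iff[OF S' fV[OF xy(1)] fV[OF xy(2)]] repf xy by simp
      also have "\<dots> \<longleftrightarrow> map_prod \<phi> \<phi> (D.rep x, D.rep y) \<in> map_prod \<phi> \<phi> ` parcs (dih_pair S)"
        by (simp add: \<phi>(3))
      also have "\<dots> \<longleftrightarrow> (D.rep x, D.rep y) \<in> parcs (dih_pair S)"
        using dih_pair_wf[of S] xy
        by (intro inj_on_image_mem_iff[OF map_prod_inj_on[OF \<phi>(1) \<phi>(1)]]) (auto simp: pverts_dih_pair)
      also have "\<dots> \<longleftrightarrow> dih_arc p S x y" using parcs_dih_pair_iff[OF S] xy by blast
      finally show ?thesis by blast
    qed
    with perm show ?thesis by (auto simp: rel_isos_def)
  qed
  have iso: "\<exists>\<phi>. inj_on \<phi> (D.rep ` ?V) \<and> D.rep ` ?V = \<phi> ` D.rep ` ?V \<and>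
      parcs (dih_pair S') = map_prod \<phi> \<phi> ` parcs (dih_pair S)"
    if f: "f \<in> rel_isos ?V (dih_arc p S) (dih_arc p S')" for f
  proof -
    define \<phi> where "\<phi> = D.rep \<circ> f \<circ> ?inv"
    have perm: "f permutes ?V" using f by (simp add: rel_isos_def)
    have \<phi>rep: "\<phi> (D.rep x) = D.rep (f x)" if "x \<in> ?V" for x using that by (simp add: \<phi>_def rinv)
    have "inj_on \<phi> (D.rep ` ?V)"
    proof (rule inj_onI, clarify)
      fix x y assume xy: "x \<in> ?V" "y \<in> ?V" "\<phi> (D.rep x) = \<phi> (D.rep y)"
      then have "D.rep (f x) = D.rep (f y)" by (simp only: \<phi>rep)
      then have "f x = f y" using inj xy perm by (auto simp: permutes_in_image dest: inj_onD)
      then show "D.rep x = D.rep y" using permutes_inj[OF perm] by (simp add: inj_eq)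
    qed
    moreover have "\<phi> ` D.rep ` ?V = D.rep ` ?V"
    proof -
      have "\<phi> ` D.rep ` ?V = D.rep ` f ` ?V" by (simp add: image_image \<phi>rep cong: image_cong)
      then show ?thesis by (simp add: permutes_image[OF perm])
    qed
    moreover have "parcs (dih_pair S') = map_prod \<phi> \<phi> ` parcs (dih_pair S)"
    proof -
      have "map_prod \<phi> \<phi> ` parcs (dih_pair S) = map_prod D.rep D.rep ` map_prod f f `
          {(x, y). x \<in> ?V \<and> y \<in> ?V \<and> dih_arc p S x y}"
        unfolding parcs_dih_pair[OF S] image_image
        by (rule image_cong) (auto simp: \<phi>rep)
      also have "map_prod f f ` {(x, y). x \<in> ?V \<and> y \<in> ?V \<and> dih_arc p S x y} =
          {(x, y). x \<in> ?V \<and> y \<in> ?V \<and> dih_arc p S' x y}" (is "?L = ?R")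
      proof
        show "?L \<subseteq> ?R" using f perm by (auto simp: rel_isos_def permutes_in_image)
        show "?R \<subseteq> ?L"
        proof clarify
          fix i a j b
          assume xy: "(i, a) \<in> ?V" "(j, b) \<in> ?V" "dih_arc p S' (i, a) (j, b)"
          then obtain x y where "x \<in> ?V" "y \<in> ?V" "f x = (i, a)" "f y = (j, b)"
            using permutes_image[OF perm] by (metis imageE)
          with xy f show "((i, a), (j, b)) \<in> ?L"
            by (intro image_eqI[of _ _ "(x, y)"]) (auto simp: rel_isos_def)
        qed
      qed
      finally show ?thesis by (simp add: parcs_dih_pair[OF S'])
    qed
    ultimately show ?thesis by (intro exI[of _ \<phi>]) simp
  qed
  show ?thesis
    unfolding dih_Cay_eq digraph_iso_with_proj_iff[OF dih_pair_wf] pverts_dih_pair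
  proof
    assume "rel_isos ?V (dih_arc p S) (dih_arc p S') \<noteq> {}"
    then obtain f where "f \<in> rel_isos ?V (dih_arc p S) (dih_arc p S')" by (meson ex_in_conv)
    then show "\<exists>\<phi>. inj_on \<phi> (D.rep ` ?V) \<and> D.rep ` ?V = \<phi> ` D.rep ` ?V \<and>
      parcs (dih_pair S') = map_prod \<phi> \<phi> ` parcs (dih_pair S)" by (rule iso)
  qed (elim exE conjE, rule vert_map)
qed

lemma dih_Cay_connected_iff:
  assumes S: "S \<subseteq> layered p"
  shows "Digraph_Component.connected (dih_Cay S) \<longleftrightarrow>
    (\<forall>C \<subseteq> layered p. C \<noteq> {} \<longrightarrow>
      (\<forall>x\<in>layered p. \<forall>y\<in>layered p. dih_arc p S x y \<longrightarrow> (x \<in> C \<longleftrightarrow> y \<in> C)) \<longrightarrow> C = layered p)"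
proof -
  let ?V = "layered p :: (int \<times> bool) set"
  have inj: "inj_on D.rep ?V" using rep_bij by (rule bij_betw_imp_inj_on)
  have ne: "?V \<noteq> {}" by (rule layered_nonempty)
  have sub: "(\<forall>C \<subseteq> D.rep ` ?V. Q C) \<longleftrightarrow> (\<forall>C \<subseteq> ?V. Q (D.rep ` C))" for Q
    unfolding subset_image_iff by blast
  have arcs: "(\<forall>(g, h) \<in> parcs (dih_pair S). g \<in> D.rep ` C \<longleftrightarrow> h \<in> D.rep ` C) \<longleftrightarrow>
      (\<forall>x\<in>?V. \<forall>y\<in>?V. dih_arc p S x y \<longrightarrow> (x \<in> C \<longleftrightarrow> y \<in> C))" if "C \<subseteq> ?V" for C
    unfolding parcs_dih_pair[OF S] by (auto simp: rep_in_image_iff[OF that])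
  have eq: "D.rep ` C = D.rep ` ?V \<longleftrightarrow> C = ?V" if "C \<subseteq> ?V" for C
    using inj that by (meson inj_on_image_eq_iff order.refl)
  show ?thesis
    unfolding dih_Cay_eq connected_with_proj_iff[OF dih_pair_wf] pverts_dih_pair sub
    using ne by (simp add: arcs eq)
qed

text \<open>Rotations alone never leave the rotations, and a single reflection generates a subgroup
  of order 2. A reflection together with a second element yields a nontrivial rotation, which
  generates all rotations because p is prime.\<close>

lemma dih_Cay_connected:
  assumes S: "S \<subseteq> layered p - {(0, False)}"
  shows "Digraph_Component.connected (dih_Cay S) \<longleftrightarrow> (\<exists>i. (i, True) \<in> S) \<and> card S \<ge> 2"
proof -
  let ?V = "layered p :: (int \<times> bool) set"
  have SV: "S \<subseteq> ?V" using S by blast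
  have finS: "finite S" using SV finite_layered finite_subset by blast
  have V0: "(0, b) \<in> ?V" for b using p_gt_2 by (simp add: layered_def)
  have Vmod: "(i mod int p, b) \<in> ?V" for i b by (simp add: layered_def)
  show ?thesis
    unfolding dih_Cay_connected_iff[OF SV]
  proof
    assume conn: "\<forall>C \<subseteq> ?V. C \<noteq> {} \<longrightarrow>
      (\<forall>x\<in>?V. \<forall>y\<in>?V. dih_arc p S x y \<longrightarrow> (x \<in> C \<longleftrightarrow> y \<in> C)) \<longrightarrow> C = ?V"
    have ex: "\<exists>i. (i, True) \<in> S"
    proof (rule ccontr)
      assume no: "\<not> ?thesis"
      define C where "C = {x \<in> ?V. \<not> snd x}"
      have "x \<in> C \<longleftrightarrow> y \<in> C" if "x \<in> ?V" "y \<in> ?V" "dih_arc p S x y" for x y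
      proof (rule ccontr)
        assume "\<not> ?thesis"
        then have "snd x \<noteq> snd y" using that by (auto simp: C_def)
        then show False using that no by (simp add: dih_arc_def dih_diff_def)
      qed
      moreover have "(0, False) \<in> C" using V0 by (simp add: C_def)
      moreover have "C \<subseteq> ?V" by (auto simp: C_def)
      ultimately have "C = ?V" using conn by blast
      then have "(0, True) \<in> C" using V0 by blast
      then show False by (simp add: C_def)
    qed
    then obtain n where n: "(n, True) \<in> S" by blast
    have "card S \<ge> 2"
    proof (rule ccontr)
      assume "\<not> card S \<ge> 2"
      moreover have "card S > 0" using n finS by (auto simp: card_gt_0_iff)
      ultimately have "card S = 1" by linarith
      then have Sn: "S = {(n, True)}" using n by (auto simp: card_1_singleton_iff)
      \<comment> \<open>The subgroup generated by the only element of \<open>S\<close>; the rotation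
        \<tau> lies outside it.\<close>
      define C where "C = {(0, False), (n mod int p, True)}"
      have "x \<in> C \<longleftrightarrow> y \<in> C" if xy: "x \<in> ?V" "y \<in> ?V" "dih_arc p S x y" for x y
      proof -
        obtain i a j b where ij: "x = (i, a)" "y = (j, b)" by force
        have bd: "0 \<le> i" "i < int p" "0 \<le> j" "j < int p" using xy by (auto simp: ij layered_def)
        have n': "n mod int p = n" using n SV by (auto simp: layered_def)
        have ab: "b = (\<not> a)" and d: "(if a then i - j else j - i) mod int p = n"
          using xy(3) by (auto simp: Sn ij dih_arc_def dih_diff_def)
        show ?thesis
        proof (cases a)
          case True
          have "i = (n + j) mod int p" using d True bd by (auto simp: mod_simps)
          moreover have "j = (i - n) mod int p" using d True bd by (auto simp: mod_simps)
          ultimately show ?thesis using True ab n' bd by (auto simp: C_def ij)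
        next
          case False
          have "j = (n + i) mod int p" using d False bd by (auto simp: mod_simps)
          moreover have "i = (j - n) mod int p" using d False bd by (auto simp: mod_simps)
          ultimately show ?thesis using False ab n' bd by (auto simp: C_def ij)
        qed
      qed
      moreover have "C \<subseteq> ?V" "C \<noteq> {}" using V0 Vmod by (auto simp: C_def)
      ultimately have "C = ?V" using conn by blast
      moreover have "(1, False) \<in> ?V" using p_gt_2 by (simp add: layered_def)
      ultimately have "(1, False) \<in> C" by simp
      then show False by (simp add: C_def)
    qed
    with ex show "(\<exists>i. (i, True) \<in> S) \<and> card S \<ge> 2" by blast
  next
    assume "(\<exists>i. (i, True) \<in> S) \<and> card S \<ge> 2"
    then obtain n where n: "(n, True) \<in> S" and c2: "card S \<ge> 2" by blast
    have n': "n mod int p = n" using n SV by (auto simp: layered_def)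
    have "S \<noteq> {(n, True)}" using c2 by auto
    then obtain m b where m: "(m, b) \<in> S" "(m, b) \<noteq> (n, True)" using n by auto
    have m': "m mod int p = m" using m SV by (auto simp: layered_def)
    show "\<forall>C \<subseteq> ?V. C \<noteq> {} \<longrightarrow>
      (\<forall>x\<in>?V. \<forall>y\<in>?V. dih_arc p S x y \<longrightarrow> (x \<in> C \<longleftrightarrow> y \<in> C)) \<longrightarrow> C = ?V"
    proof (intro allI impI)
      fix C assume C: "C \<subseteq> ?V" "C \<noteq> {}"
        and cl: "\<forall>x\<in>?V. \<forall>y\<in>?V. dih_arc p S x y \<longrightarrow> (x \<in> C \<longleftrightarrow> y \<in> C)"
      have step: "(i mod int p, False) \<in> C \<longleftrightarrow> ((i + q) mod int p, a) \<in> C" if "(q, a) \<in> S" for i q a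
      proof -
        have "q mod int p = q" using that SV by (auto simp: layered_def)
        then have "dih_arc p S (i mod int p, False) ((i + q) mod int p, a)"
          using that by (cases a) (simp_all add: dih_arc_def dih_diff_def mod_simps)
        then show ?thesis using cl Vmod by blast
      qed
      \<comment> \<open>The exponent of the rotation obtained: along the arc of the reflection
        \<open>n\<close> and back along that of the reflection \<open>m\<close>, or directly along
        the rotation \<open>m\<close>.\<close>
      define e where "e = (if b then n - m else m)"
      have e: "\<not> int p dvd e"
      proof
        assume "int p dvd e"
        then have "m mod int p = (if b then n else 0) mod int p"
          by (cases b) (simp_all add: e_def mod_eq_dvd_iff dvd_diff_commute)
        then show False using m S m' n' by (cases b) auto
      qed
      have inv: "(i mod int p, False) \<in> C \<longleftrightarrow> ((i + e) mod int p, False) \<in> C" for i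
      proof (cases b)
        case True
        have "(i mod int p, False) \<in> C \<longleftrightarrow> ((i + n) mod int p, True) \<in> C" by (rule step[OF n])
        also have "\<dots> \<longleftrightarrow> ((i + e) mod int p, False) \<in> C"
          using step[of m True "i + e"] m(1) True by (simp add: e_def)
        finally show ?thesis .
      next
        case False
        then show ?thesis using step[of m False i] m(1) by (simp add: e_def)
      qed
      have const: "(i mod int p, False) \<in> C \<longleftrightarrow> (j mod int p, False) \<in> C" for i j
        using constant_if_invariant_under_step[OF e, of "\<lambda>i. (i, False) \<in> C"] inv by blast
      have constT: "(i mod int p, True) \<in> C \<longleftrightarrow> (j mod int p, False) \<in> C" for i j
        using step[OF n, of "i - n"] const[of "i - n" j] by simp
      have all: "(i mod int p, a) \<in> C \<longleftrightarrow> (0 mod int p, False) \<in> C" for i a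
        by (cases a) (simp_all only: const[of i 0] constT[of i 0])
      obtain i a where ia: "(i, a) \<in> C" using C(2) by auto
      then have "i mod int p = i" using C(1) by (auto simp: layered_def)
      then have "(0 mod int p, False) \<in> C" using ia all[of i a] by simp
      then have "(j, b') \<in> C" if "(j, b') \<in> ?V" for j b'
        using all[of j b'] that by (simp add: layered_def)
      then show "C = ?V" using C(1) by auto
    qed
  qed
qed

section \<open>Counting orbits\<close>

definition conn_sets :: "nat \<Rightarrow> (int \<times> bool) set set" where
  "conn_sets k = {S. S \<subseteq> layered p - {(0, False)} \<and> card S = k \<and> (\<exists>i. (i, True) \<in> S)}"

text \<open>The affine maps \<open>x \<mapsto> u x + v\<close> over the field with p elements, with
  reduced coefficients; by \<open>dih_aff\<close> these act as automorphisms of the dihedral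
  group.\<close>

definition aff_group :: "(int \<times> int) monoid" where
  "aff_group = \<lparr> carrier = {1..<int p} \<times> {0..<int p},
    mult = (\<lambda>g h. ((fst g * fst h) mod int p, (fst g * snd h + snd g) mod int p)), one = (1, 0) \<rparr>"

text \<open>Restricted to \<open>conn_sets k\<close>, because the elements of
  \<open>BijGroup\<close> are extensional functions.\<close>

definition aff_act :: "nat \<Rightarrow> int \<times> int \<Rightarrow> (int \<times> bool) set \<Rightarrow> (int \<times> bool) set" where
  "aff_act k g = (\<lambda>S\<in>conn_sets k. dih_aff p (fst g) (snd g) ` S)"

lemma unit_iff: "u mod int p \<in> {1..<int p} \<longleftrightarrow> \<not> int p dvd u"
  using mod_p_bounds[of u] by (auto simp: dvd_eq_mod_eq_0 simp del: mod_p_bounds)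

lemma unit_not_dvd: "u \<in> {1..<int p} \<Longrightarrow> \<not> int p dvd u"
  using unit_iff[of u] by simp

lemma finite_conn_sets: "finite (conn_sets k)"
  by (rule finite_subset[of _ "Pow (layered p)"]) (auto simp: conn_sets_def finite_layered)

lemma group_aff_group: "group aff_group"
proof (rule groupI)
  fix g h assume "g \<in> carrier aff_group" "h \<in> carrier aff_group"
  then have "\<not> int p dvd fst g" "\<not> int p dvd fst h"
    using unit_not_dvd by (auto simp: aff_group_def)
  then have "\<not> int p dvd fst g * fst h" using prime_int_p by (simp add: prime_dvd_mult_iff)
  then show "g \<otimes>\<^bsub>aff_group\<^esub> h \<in> carrier aff_group"
    using unit_iff[of "fst g * fst h"] by (simp add: aff_group_def)
next
  show "\<one>\<^bsub>aff_group\<^esub> \<in> carrier aff_group" using p_gt_2 by (simp add: aff_group_def)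
next
  fix g h l
  show "g \<otimes>\<^bsub>aff_group\<^esub> h \<otimes>\<^bsub>aff_group\<^esub> l = g \<otimes>\<^bsub>aff_group\<^esub> (h \<otimes>\<^bsub>aff_group\<^esub> l)"
    by (simp add: aff_group_def affine_mod_simps mod_simps) (simp add: algebra_simps)
next
  fix g assume "g \<in> carrier aff_group"
  then show "\<one>\<^bsub>aff_group\<^esub> \<otimes>\<^bsub>aff_group\<^esub> g = g" by (cases g) (simp add: aff_group_def)
next
  fix g assume g: "g \<in> carrier aff_group"
  then have "\<not> int p dvd fst g" using unit_not_dvd by (auto simp: aff_group_def)
  then obtain u where u: "u * fst g mod int p = 1" "\<not> int p dvd u" using modular_inverse by blast
  let ?h = "(u mod int p, (- u * snd g) mod int p)"
  have "?h \<in> carrier aff_group" using u(2) unit_iff[of u] by (simp add: aff_group_def)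
  moreover have "?h \<otimes>\<^bsub>aff_group\<^esub> g = \<one>\<^bsub>aff_group\<^esub>"
  proof -
    have "(u mod int p * snd g - u * snd g) mod int p = 0"
      by (metis mod_diff_left_eq mod_mult_left_eq diff_self mod_0)
    then show ?thesis using u(1) by (simp add: aff_group_def affine_mod_simps mod_simps)
  qed
  ultimately show "\<exists>h\<in>carrier aff_group. h \<otimes>\<^bsub>aff_group\<^esub> g = \<one>\<^bsub>aff_group\<^esub>" by blast
qed

lemma dih_aff_inj: "\<not> int p dvd u \<Longrightarrow> inj_on (dih_aff p u v) (layered p)"
proof -
  assume "\<not> int p dvd u"
  then obtain u' v' where "\<And>x. x \<in> layered p \<Longrightarrow> dih_aff p u' v' (dih_aff p u v x) = x"
    using dih_aff_inverse[of u v] by metis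
  then show ?thesis by (rule inj_on_inverseI)
qed

lemma dih_aff_image_conn_sets:
  assumes u: "\<not> int p dvd u" and S: "S \<in> conn_sets k"
  shows "dih_aff p u v ` S \<in> conn_sets k"
proof -
  have inj: "inj_on (dih_aff p u v) (layered p)" by (rule dih_aff_inj[OF u])
  have SV: "S \<subseteq> layered p" "(0, False) \<notin> S" using S by (auto simp: conn_sets_def)
  have 0: "dih_aff p u v (0, False) = (0, False)" by (simp add: dih_aff_def)
  have V0: "(0, False) \<in> layered p" using p_gt_2 by (simp add: layered_def)
  have "(0, False) \<notin> dih_aff p u v ` S"
    using inj_on_image_mem_iff[OF inj V0 SV(1)] SV(2) 0 by simp
  moreover have "card (dih_aff p u v ` S) = k"
    using S card_image[OF inj_on_subset[OF inj SV(1)]] by (simp add: conn_sets_def)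
  moreover obtain i where "(i, True) \<in> S" using S by (auto simp: conn_sets_def)
  then have "((u * i + v) mod int p, True) \<in> dih_aff p u v ` S"
    by (intro image_eqI[of _ _ "(i, True)"]) (simp_all add: dih_aff_def)
  ultimately show ?thesis using dih_aff_closed by (auto simp: conn_sets_def)
qed

lemma aff_group_mult_act:
  "dih_aff p (fst (g \<otimes>\<^bsub>aff_group\<^esub> h)) (snd (g \<otimes>\<^bsub>aff_group\<^esub> h)) x =
    dih_aff p (fst g) (snd g) (dih_aff p (fst h) (snd h) x)"
  by (simp add: aff_group_def dih_aff_comp dih_aff_mod)

lemma aff_act_closed:
  assumes "g \<in> carrier aff_group" "S \<in> conn_sets k"
  shows "aff_act k g S \<in> conn_sets k"
  using assms dih_aff_image_conn_sets[OF unit_not_dvd] by (auto simp: aff_act_def aff_group_def)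

lemma aff_act_mult:
  assumes "h \<in> carrier aff_group" "S \<in> conn_sets k"
  shows "aff_act k (g \<otimes>\<^bsub>aff_group\<^esub> h) S = aff_act k g (aff_act k h S)"
proof -
  have "aff_act k g (aff_act k h S) = dih_aff p (fst g) (snd g) ` aff_act k h S"
    using aff_act_closed[OF assms] by (simp add: aff_act_def[of k g])
  then show ?thesis using assms by (simp add: aff_act_def image_image aff_group_mult_act)
qed

lemma aff_act_one:
  assumes "S \<in> conn_sets k"
  shows "aff_act k \<one>\<^bsub>aff_group\<^esub> S = S"
proof -
  have "dih_aff p 1 0 ` S = id ` S"
    using assms by (intro image_cong) (auto simp: conn_sets_def intro!: dih_aff_one)
  then show ?thesis using assms by (simp add: aff_act_def aff_group_def)
qed

lemma aff_act_Bij: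
  assumes g: "g \<in> carrier aff_group"
  shows "aff_act k g \<in> Bij (conn_sets k)"
proof -
  interpret A: group aff_group by (rule group_aff_group)
  have "bij_betw (aff_act k g) (conn_sets k) (conn_sets k)"
    by (rule bij_betw_byWitness[where f' = "aff_act k (inv\<^bsub>aff_group\<^esub> g)"])
      (use g in \<open>auto simp: aff_act_closed aff_act_one simp flip: aff_act_mult\<close>)
  then show ?thesis by (simp add: Bij_def aff_act_def)
qed

lemma aff_group_action: "group_action aff_group (conn_sets k) (aff_act k)"
proof (intro group_action.intro group_hom.intro group_hom_axioms.intro homI)
  show "group aff_group" by (rule group_aff_group)
  show "group (BijGroup (conn_sets k))" by (rule group_BijGroup)
  show "aff_act k g \<in> carrier (BijGroup (conn_sets k))" if "g \<in> carrier aff_group" for g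
    using aff_act_Bij[OF that] by (simp add: BijGroup_def)
  show "aff_act k (g \<otimes>\<^bsub>aff_group\<^esub> h) = aff_act k g \<otimes>\<^bsub>BijGroup (conn_sets k)\<^esub> aff_act k h"
    if "g \<in> carrier aff_group" "h \<in> carrier aff_group" for g h
  proof
    fix S
    have "aff_act k g \<otimes>\<^bsub>BijGroup (conn_sets k)\<^esub> aff_act k h =
        compose (conn_sets k) (aff_act k g) (aff_act k h)"
      using aff_act_Bij that by (simp add: BijGroup_def)
    then show "aff_act k (g \<otimes>\<^bsub>aff_group\<^esub> h) S = (aff_act k g \<otimes>\<^bsub>BijGroup (conn_sets k)\<^esub> aff_act k h) S"
      using that(2) by (cases "S \<in> conn_sets k")
        (simp_all add: compose_def aff_act_mult, simp add: aff_act_def)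
  qed
qed

text \<open>A group automorphism commutes with \<open>y x\<^sup>-\<^sup>1\<close>, so it is an
  isomorphism onto the digraph of the image set.\<close>

lemma dih_aff_rel_iso:
  assumes u: "\<not> int p dvd u" and S: "S \<subseteq> layered p"
  shows "rel_isos (layered p) (dih_arc p S) (dih_arc p (dih_aff p u v ` S)) \<noteq> {}"
proof -
  define f where "f x = (if x \<in> layered p then dih_aff p u v x else x)" for x
  have inj: "inj_on (dih_aff p u v) (layered p)" by (rule dih_aff_inj[OF u])
  then have "inj_on f (layered p)" by (simp add: f_def inj_on_def)
  moreover have "f ` layered p \<subseteq> layered p" by (auto simp: f_def dih_aff_closed)
  ultimately have "bij_betw f (layered p) (layered p)"
    by (simp add: bij_betw_def endo_inj_surj finite_layered)
  then have "f permutes layered p" by (rule bij_imp_permutes) (simp add: f_def)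
  moreover have "dih_arc p S x y \<longleftrightarrow> dih_arc p (dih_aff p u v ` S) (f x) (f y)"
    if "x \<in> layered p" "y \<in> layered p" for x y
  proof -
    have "dih_diff p (dih_aff p u v x) (dih_aff p u v y) = dih_aff p u v (dih_diff p x y)"
      by (cases "snd x"; cases "snd y") (simp_all add: dih_diff_def dih_aff_def mod_simps
          affine_mod_simps algebra_simps)
    then show ?thesis
      using that inj_on_image_mem_iff[OF inj dih_diff_closed S] by (simp add: f_def dih_arc_def)
  qed
  ultimately show ?thesis by (auto simp: rel_isos_def)
qed

lemma conn_sets_iso_iff:
  assumes S: "S \<in> conn_sets k" and S': "S' \<in> conn_sets k"
  shows "digraph_iso (dih_Cay S) (dih_Cay S') \<longleftrightarrow> S' \<in> orbit aff_group (aff_act k) S"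
proof -
  have sub: "S \<subseteq> layered p" "S' \<subseteq> layered p" using S S' by (auto simp: conn_sets_def)
  have orb: "S' \<in> orbit aff_group (aff_act k) S \<longleftrightarrow>
      (\<exists>g\<in>carrier aff_group. S' = dih_aff p (fst g) (snd g) ` S)"
    using S by (simp add: orbit_def aff_act_def Bex_def) blast
  show ?thesis
    unfolding dih_Cay_iso_iff[OF sub] orb
  proof
    assume "rel_isos (layered p) (dih_arc p S) (dih_arc p S') \<noteq> {}"
    then obtain f where "f \<in> rel_isos (layered p) (dih_arc p S) (dih_arc p S')" by (meson ex_in_conv)
    then have "\<exists>u v. \<not> int p dvd u \<and> (\<forall>x\<in>layered p. x \<in> S \<longleftrightarrow> dih_aff p u v x \<in> S')"
      using S S' by (intro dih_iso_imp_aff) (auto simp: conn_sets_def)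
    then obtain u v where u: "\<not> int p dvd u" and
      uv: "\<forall>x\<in>layered p. x \<in> S \<longleftrightarrow> dih_aff p u v x \<in> S'" by blast
    obtain u' v' where inv: "\<And>x. x \<in> layered p \<Longrightarrow> dih_aff p u v (dih_aff p u' v' x) = x"
      using dih_aff_inverse[OF u] by metis
    have "S' = dih_aff p u v ` S"
    proof
      show "S' \<subseteq> dih_aff p u v ` S"
      proof
        fix y assume y: "y \<in> S'"
        then have "dih_aff p u v (dih_aff p u' v' y) = y" using inv sub by blast
        moreover from this have "dih_aff p u' v' y \<in> S" using uv y dih_aff_closed by metis
        ultimately show "y \<in> dih_aff p u v ` S" by (metis image_eqI)
      qed
      show "dih_aff p u v ` S \<subseteq> S'" using uv sub by blast
    qed
    also have "\<dots> = dih_aff p (u mod int p) (v mod int p) ` S" by (simp add: dih_aff_mod)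
    finally have "S' = dih_aff p (u mod int p) (v mod int p) ` S" .
    moreover have "(u mod int p, v mod int p) \<in> carrier aff_group"
      using u unit_iff[of u] by (simp add: aff_group_def)
    ultimately show "\<exists>g\<in>carrier aff_group. S' = dih_aff p (fst g) (snd g) ` S"
      by (metis fst_conv snd_conv)
  next
    assume "\<exists>g\<in>carrier aff_group. S' = dih_aff p (fst g) (snd g) ` S"
    then obtain u v where "u \<in> {1..<int p}" "S' = dih_aff p u v ` S" by (auto simp: aff_group_def)
    then show "rel_isos (layered p) (dih_arc p S) (dih_arc p S') \<noteq> {}"
      using dih_aff_rel_iso[OF unit_not_dvd sub(1)] by blast
  qed
qed

text \<open>All out-degrees equal the size of the connection set, so degree k < 2 contradicts the
  connectedness criterion, and for k \<ge> 2 the criterion only asks for a reflection.\<close>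

lemma conn_Cayley_digraphs_eq:
  "conn_Cayley_digraphs D k = (if k \<ge> 2 then dih_Cay ` conn_sets k else {})"
proof -
  have inj: "inj_on D.rep (layered p)" using rep_bij by (rule bij_betw_imp_inj_on)
  have img: "D.rep ` layered p = carrier D" using rep_bij by (simp add: bij_betw_def)
  have V0: "(0, False) \<in> layered p" using p_gt_2 by (simp add: layered_def)
  have verts: "verts (dih_Cay S) = carrier D" for S by (simp add: Cay_def)
  have deg: "(\<forall>v\<in>verts (dih_Cay S). out_degree (dih_Cay S) v = k) \<longleftrightarrow> card S = k"
    if "S \<subseteq> layered p" for S
  proof -
    have "D.rep ` S \<subseteq> carrier D" using that img by blast
    then have "out_degree (dih_Cay S) v = card S" if "v \<in> carrier D" for v
      using D.out_degree_Cay that card_image[OF inj_on_subset[OF inj \<open>S \<subseteq> layered p\<close>]] by simp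
    then show ?thesis unfolding verts using D.one_closed by auto
  qed
  have "X \<in> conn_Cayley_digraphs D k \<longleftrightarrow>
    (\<exists>S. S \<subseteq> layered p - {(0, False)} \<and> X = dih_Cay S \<and> (\<exists>i. (i, True) \<in> S) \<and> card S \<ge> 2 \<and> card S = k)"
    for X
  proof
    assume X: "X \<in> conn_Cayley_digraphs D k"
    then obtain T where T: "T \<subseteq> carrier D" "\<one>\<^bsub>D\<^esub> \<notin> T" "X = Cay D T"
      by (auto simp: conn_Cayley_digraphs_def)
    obtain S where S: "S \<subseteq> layered p" "T = D.rep ` S"
      using T(1) unfolding img[symmetric] by (meson subset_imageE)
    have "(0, False) \<notin> S" using T(2) S rep_one by (metis image_eqI)
    then have S0: "S \<subseteq> layered p - {(0, False)}" using S by blast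
    have "Digraph_Component.connected (dih_Cay S)" "\<forall>v\<in>verts (dih_Cay S). out_degree (dih_Cay S) v = k"
      using X T S by (simp_all add: conn_Cayley_digraphs_def)
    then show "\<exists>S. S \<subseteq> layered p - {(0, False)} \<and> X = dih_Cay S \<and> (\<exists>i. (i, True) \<in> S) \<and>
        card S \<ge> 2 \<and> card S = k"
      using S0 T(3) S dih_Cay_connected[OF S0] deg[OF S(1)] by blast
  next
    assume "\<exists>S. S \<subseteq> layered p - {(0, False)} \<and> X = dih_Cay S \<and> (\<exists>i. (i, True) \<in> S) \<and>
        card S \<ge> 2 \<and> card S = k"
    then obtain S where S: "S \<subseteq> layered p - {(0, False)}" "X = dih_Cay S" "\<exists>i. (i, True) \<in> S"
      "card S \<ge> 2" "card S = k" by blast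
    have sub: "S \<subseteq> layered p" "(0, False) \<notin> S" using S(1) by blast+
    have "\<one>\<^bsub>D\<^esub> \<notin> D.rep ` S" using rep_in_image_iff[OF sub(1) V0] sub(2) rep_one by simp
    moreover have "D.rep ` S \<subseteq> carrier D" using sub(1) img by blast
    ultimately show "X \<in> conn_Cayley_digraphs D k"
      unfolding conn_Cayley_digraphs_def
      using S dih_Cay_connected[OF S(1)] deg[OF sub(1)] by blast
  qed
  then show ?thesis by (auto simp: conn_sets_def)
qed

theorem num_conn_Cayley_digraphs_eq_orbits:
  "num_conn_Cayley_digraphs D k = (if k \<ge> 2 then card (orbits aff_group (conn_sets k) (aff_act k)) else 0)"
proof (cases "k \<ge> 2")
  case True
  interpret A: group_action aff_group "conn_sets k" "aff_act k" by (rule aff_group_action)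
  let ?P = "conn_sets k"
  define r where "r = {(S, S'). S \<in> ?P \<and> S' \<in> orbit aff_group (aff_act k) S}"
  define s where "s = {(X, Y). X \<in> dih_Cay ` ?P \<and> Y \<in> dih_Cay ` ?P \<and> digraph_iso X Y}"
  have orbP: "S' \<in> ?P" if "S \<in> ?P" "S' \<in> orbit aff_group (aff_act k) S" for S S'
    using that A.element_image by (auto simp: orbit_def)
  have eqv: "equiv ?P r"
  proof (rule equivI)
    show "r \<subseteq> ?P \<times> ?P" using orbP by (auto simp: r_def)
    show "refl_on ?P r" by (rule refl_onI) (simp add: r_def A.orbit_refl)
    show "sym r" by (rule symI) (use orbP A.orbit_sym in \<open>auto simp: r_def\<close>)
    show "trans r" by (rule transI) (use orbP A.orbit_trans in \<open>simp add: r_def, blast\<close>)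
  qed
  have "num_conn_Cayley_digraphs D k = card ((dih_Cay ` ?P) // s)"
    using True by (simp add: num_conn_Cayley_digraphs_def conn_Cayley_digraphs_eq s_def)
  also have "\<dots> = card (?P // r)"
    by (rule card_quotient_image[OF eqv]) (auto simp: s_def r_def conn_sets_iso_iff)
  also have "?P // r = orbits aff_group ?P (aff_act k)"
    by (auto simp: quotient_def orbits_def r_def)
  finally show ?thesis using True by simp
next
  case False
  then show ?thesis by (simp add: num_conn_Cayley_digraphs_def conn_Cayley_digraphs_eq)
qed

lemma conn_sets_burnside:
  "card (orbits aff_group (conn_sets k) (aff_act k)) * ((p - 1) * p) =
    (\<Sum>u\<in>{1..<int p}. \<Sum>v\<in>{0..<int p}. card {S \<in> conn_sets k. dih_aff p u v ` S = S})"
proof -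
  interpret A: group_action aff_group "conn_sets k" "aff_act k" by (rule aff_group_action)
  have fin: "finite (carrier aff_group)" by (simp add: aff_group_def)
  have "order aff_group = (p - 1) * p"
    using p_gt_2 by (simp add: order_def aff_group_def nat_diff_distrib')
  then have "card (orbits aff_group (conn_sets k) (aff_act k)) * ((p - 1) * p) =
      (\<Sum>g\<in>carrier aff_group. card (invariants (conn_sets k) (aff_act k) g))"
    using A.burnside[OF fin finite_conn_sets] by simp
  also have "\<dots> = (\<Sum>g\<in>{1..<int p} \<times> {0..<int p}.
      card {S \<in> conn_sets k. dih_aff p (fst g) (snd g) ` S = S})"
    by (rule sum.cong) (auto simp: aff_group_def invariants_def aff_act_def intro!: arg_cong[of _ _ card])
  also have "\<dots> = (\<Sum>u\<in>{1..<int p}. \<Sum>v\<in>{0..<int p}. card {S \<in> conn_sets k. dih_aff p u v ` S = S})"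
    by (simp add: sum.cartesian_product case_prod_beta)
  finally show ?thesis .
qed

end

section \<open>Subsets invariant under a map with cycles of equal length\<close>

text \<open>The set \<open>E\<close> falls into \<open>card E div d\<close> cycles of length
  \<open>d\<close>, and an invariant subset is a union of cycles, so it amounts to a choice of
  \<open>k div d\<close> of them.\<close>

lemma card_invariant_subsets:
  assumes fin: "finite E" and d: "d > 0" and closed: "\<And>x. x \<in> E \<Longrightarrow> g x \<in> E"
    and period: "\<And>x n. x \<in> E \<Longrightarrow> (g ^^ n) x = x \<longleftrightarrow> d dvd n"
  shows "card {S. S \<subseteq> E \<and> card S = k \<and> g ` S = S} =
    (if d dvd k then (card E div d) choose (k div d) else 0)"
proof -
  define r where "r = {(x, y). x \<in> E \<and> (\<exists>n. y = (g ^^ n) x)}"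
  have closed_pow: "(g ^^ n) x \<in> E" if "x \<in> E" for n x
    by (induction n) (simp_all add: that closed)
  have pow_mod: "(g ^^ (n mod d)) x = (g ^^ n) x" if x: "x \<in> E" for n x
  proof -
    have "(g ^^ n) x = (g ^^ (n mod d + d * (n div d))) x" by simp
    also have "\<dots> = (g ^^ (n mod d)) ((g ^^ (d * (n div d))) x)" by (simp only: funpow_add comp_apply)
    also have "\<dots> = (g ^^ (n mod d)) x" using period[OF x, of "d * (n div d)"] by simp
    finally show ?thesis by simp
  qed
  have eqv: "equiv E r"
  proof (rule equivI)
    show "r \<subseteq> E \<times> E" using closed_pow by (auto simp: r_def)
    show "refl_on E r" by (rule refl_onI) (auto simp: r_def intro: exI[of _ "0::nat"])
    show "sym r"
    proof (rule symI)
      fix x y assume "(x, y) \<in> r"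
      then obtain n where x: "x \<in> E" and y: "y = (g ^^ n) x" by (auto simp: r_def)
      \<comment> \<open>The exponent is -n modulo \<open>d\<close>; the natural subtraction does not
        truncate because \<open>d\<close> is positive.\<close>
      have "(g ^^ (d * n - n)) y = (g ^^ (d * n - n + n)) x" by (simp add: y funpow_add)
      also have "d * n - n + n = d * n" using d by simp
      also have "(g ^^ (d * n)) x = x" using period[OF x] by simp
      finally show "(y, x) \<in> r" using closed_pow[OF x] by (auto simp: r_def y intro: HOL.sym)
    qed
    show "trans r"
    proof (rule transI)
      fix x y z assume "(x, y) \<in> r" "(y, z) \<in> r"
      then obtain m n where "x \<in> E" "z = (g ^^ m) ((g ^^ n) x)" by (auto simp: r_def)
      then have "x \<in> E" "z = (g ^^ (m + n)) x" by (simp_all add: funpow_add)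
      then show "(x, z) \<in> r" unfolding r_def by blast
    qed
  qed
  have card_class: "card C = d" if C: "C \<in> E // r" for C
  proof -
    obtain x where x: "x \<in> E" "C = r `` {x}" using C by (rule quotientE)
    have "C = (\<lambda>n. (g ^^ n) x) ` {0..<d}"
    proof
      show "C \<subseteq> (\<lambda>n. (g ^^ n) x) ` {0..<d}"
      proof
        fix y assume "y \<in> C"
        then obtain n where "y = (g ^^ n) x" by (auto simp: x r_def)
        then have "y = (g ^^ (n mod d)) x" by (simp add: pow_mod x)
        then show "y \<in> (\<lambda>n. (g ^^ n) x) ` {0..<d}" using d by auto
      qed
    qed (auto simp: x r_def)
    moreover have "inj_on (\<lambda>n. (g ^^ n) x) {0..<d}"
    proof -
      have "m = n" if "m \<le> n" "n < d" "(g ^^ m) x = (g ^^ n) x" for m n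
      proof -
        have "(g ^^ (n - m)) ((g ^^ m) x) = (g ^^ (n - m + m)) x" by (simp only: funpow_add comp_apply)
        then have "(g ^^ (n - m)) ((g ^^ m) x) = (g ^^ m) x" using that by simp
        then have "d dvd n - m" using period[OF closed_pow[OF x(1)]] by blast
        then show ?thesis using that by (auto dest: dvd_imp_le)
      qed
      then show ?thesis by (intro inj_onI) (metis atLeastLessThan_iff nle_le)
    qed
    ultimately show ?thesis by (simp add: card_image)
  qed
  have finQ: "finite (E // r)" using fin eqv by (simp add: finite_quotient equiv_def)
  have card_Union: "card (\<Union>U) = d * card U" if U: "U \<subseteq> E // r" for U
  proof -
    have "\<Union>U \<subseteq> E" using U Union_quotient[OF eqv] by blast
    then have "d * card U = card (\<Union>U)"
      using U card_class quotient_disj[OF eqv] finite_subset[OF U finQ] finite_subset[OF _ fin]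
      by (intro card_partition) blast+
    then show ?thesis by simp
  qed
  have cardE: "card E = d * card (E // r)"
    using card_Union[of "E // r"] Union_quotient[OF eqv] by simp
  have inj: "inj_on Union (Pow (E // r))"
  proof -
    have sub: "U \<subseteq> U'" if U: "U \<subseteq> E // r" "U' \<subseteq> E // r" "\<Union>U = \<Union>U'" for U U'
    proof
      fix C assume C: "C \<in> U"
      then obtain x where x: "x \<in> C" using U(1) in_quotient_imp_non_empty[OF eqv] by blast
      then obtain C' where C': "C' \<in> U'" "x \<in> C'" using U(3) C by blast
      then have "C = C'" using quotient_disj[OF eqv, of C C'] C U(1,2) x by blast
      with C' show "C \<in> U'" by simp
    qed
    show ?thesis
    proof (rule inj_onI)
      fix U U' assume "U \<in> Pow (E // r)" "U' \<in> Pow (E // r)" "\<Union>U = \<Union>U'"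
      then show "U = U'" using sub[of U U'] sub[of U' U] by simp
    qed
  qed
  have inv_iff: "{S. S \<subseteq> E \<and> g ` S = S} = Union ` Pow (E // r)"
  proof (intro equalityI subsetI)
    fix S assume "S \<in> {S. S \<subseteq> E \<and> g ` S = S}"
    then have S: "S \<subseteq> E" "g ` S = S" by auto
    have pow: "(g ^^ n) x \<in> S" if "x \<in> S" for n x
      by (induction n) (use that S(2) in auto)
    have "S = \<Union>((\<lambda>x. r `` {x}) ` S)"
    proof
      show "S \<subseteq> \<Union>((\<lambda>x. r `` {x}) ` S)" using equiv_class_self[OF eqv] S(1) by blast
      show "\<Union>((\<lambda>x. r `` {x}) ` S) \<subseteq> S" using pow by (auto simp: r_def)
    qed
    moreover have "(\<lambda>x. r `` {x}) ` S \<in> Pow (E // r)" using S(1) by (auto intro: quotientI)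
    ultimately show "S \<in> Union ` Pow (E // r)" by (rule image_eqI)
  next
    fix S assume "S \<in> Union ` Pow (E // r)"
    then obtain U where U: "U \<subseteq> E // r" "S = \<Union>U" by auto
    have SE: "S \<subseteq> E" using U Union_quotient[OF eqv] by blast
    have step: "(g ^^ n) x \<in> S" if x: "x \<in> S" for n x
    proof -
      obtain C where C: "C \<in> U" "x \<in> C" using x U by blast
      have "(x, (g ^^ n) x) \<in> r" using x SE by (auto simp: r_def)
      then have "(g ^^ n) x \<in> C" using in_quotient_imp_closed[OF eqv _ C(2)] C(1) U(1) by blast
      then show ?thesis using C U by blast
    qed
    have "g ` S = S"
    proof
      show "g ` S \<subseteq> S" using step[of _ 1] by auto
      show "S \<subseteq> g ` S"
      proof
        fix x assume x: "x \<in> S"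
        have "x = (g ^^ Suc (d - 1)) x" using period[of x d] x SE d by auto
        also have "\<dots> = g ((g ^^ (d - 1)) x)" by simp
        finally show "x \<in> g ` S" using step[OF x] by blast
      qed
    qed
    with SE show "S \<in> {S. S \<subseteq> E \<and> g ` S = S}" by simp
  qed
  have eq: "{S. S \<subseteq> E \<and> card S = k \<and> g ` S = S} = Union ` {U. U \<subseteq> E // r \<and> d * card U = k}"
  proof -
    have "{S. S \<subseteq> E \<and> card S = k \<and> g ` S = S} = {S \<in> Union ` Pow (E // r). card S = k}"
      unfolding inv_iff[symmetric] by blast
    also have "\<dots> = Union ` {U. U \<subseteq> E // r \<and> d * card U = k}"
      using card_Union by auto
    finally show ?thesis .
  qed
  have "card {S. S \<subseteq> E \<and> card S = k \<and> g ` S = S} = card {U. U \<subseteq> E // r \<and> d * card U = k}"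
    unfolding eq by (rule card_image[OF inj_on_subset[OF inj]]) auto
  also have "\<dots> = (if d dvd k then (card E div d) choose (k div d) else 0)"
  proof (cases "d dvd k")
    case True
    then have "{U. U \<subseteq> E // r \<and> d * card U = k} = {U. U \<subseteq> E // r \<and> card U = k div d}"
      using d by auto
    then show ?thesis using True finQ d by (simp add: n_subsets cardE)
  next
    case False
    then have "{U. U \<subseteq> E // r \<and> d * card U = k} = {}" by auto
    then show ?thesis using False by (simp only: card.empty if_False)
  qed
  finally show ?thesis .
qed

section \<open>Connection sets fixed by an affine map\<close>

context odd_prime
begin

definition rotations :: "(int \<times> bool) set" where
  "rotations = {1..<int p} \<times> {False}"

lemma card_rotations: "card rotations = p - 1"
  using p_gt_2 by (simp add: rotations_def nat_diff_distrib')

lemma card_layered_bool: "card (layered p :: (int \<times> bool) set) = 2 * p"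
  by (simp add: layered_def)

lemma rotations_eq: "rotations = {x \<in> layered p - {(0, False)}. \<not> snd x}"
  by (auto simp: rotations_def layered_def)

lemma subset_rotations_iff:
  assumes "S \<subseteq> layered p - {(0, False)}"
  shows "S \<subseteq> rotations \<longleftrightarrow> \<not> (\<exists>i. (i, True) \<in> S)"
  using assms by (auto simp: rotations_eq)

definition fixed_sets :: "int \<Rightarrow> int \<Rightarrow> (int \<times> bool) set \<Rightarrow> nat \<Rightarrow> (int \<times> bool) set set" where
  "fixed_sets u v E k = {S. S \<subseteq> E \<and> card S = k \<and> dih_aff p u v ` S = S}"

lemma finite_fixed_sets: "finite E \<Longrightarrow> finite (fixed_sets u v E k)"
  by (rule finite_subset[of _ "Pow E"]) (auto simp: fixed_sets_def)

text \<open>A set without reflections is a set of nontrivial rotations. The complement count is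
  stated as a sum to avoid natural subtraction.\<close>

lemma card_fixed_conn_sets:
  "card {S \<in> conn_sets k. dih_aff p u v ` S = S} + card (fixed_sets u v rotations k) =
    card (fixed_sets u v (layered p - {(0, False)}) k)"
proof -
  let ?W = "layered p - {(0, False)} :: (int \<times> bool) set"
  have RW: "rotations \<subseteq> ?W" by (auto simp: rotations_eq)
  have "fixed_sets u v ?W k = {S \<in> conn_sets k. dih_aff p u v ` S = S} \<union> fixed_sets u v rotations k"
    using subset_rotations_iff RW unfolding fixed_sets_def conn_sets_def by blast
  moreover have "{S \<in> conn_sets k. dih_aff p u v ` S = S} \<inter> fixed_sets u v rotations k = {}"
  proof -
    have "\<not> S \<subseteq> rotations" if "S \<in> conn_sets k" for S
      using that subset_rotations_iff[of S] by (simp add: conn_sets_def)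
    then show ?thesis by (auto simp: fixed_sets_def)
  qed
  moreover have "finite rotations" by (simp add: rotations_def)
  ultimately show ?thesis using finite_conn_sets finite_fixed_sets
    by (simp add: card_Un_disjoint)
qed

text \<open>The translation fixes every rotation and permutes the p reflections in one cycle. An
  invariant set with a reflection therefore contains all reflections, and only its k - p rotations
  are free.\<close>

lemma card_fixed_conn_sets_translation:
  assumes v: "v \<in> {1..<int p}"
  shows "card {S \<in> conn_sets k. dih_aff p 1 v ` S = S} = (if k \<ge> p then (p - 1) choose (k - p) else 0)"
proof -
  define T :: "(int \<times> bool) set" where "T = {0..<int p} \<times> {True}"
  have finR: "finite rotations" by (simp add: rotations_def)
  have finT: "finite T" "card T = p" by (simp_all add: T_def)
  have disj: "R \<inter> T = {}" if "R \<subseteq> rotations" for R using that by (auto simp: rotations_def T_def)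
  have affR: "dih_aff p 1 v x = x" if "x \<in> rotations" for x
    using that by (auto simp: rotations_def dih_aff_def)
  have affT: "dih_aff p 1 v ` T = T"
  proof
    show "dih_aff p 1 v ` T \<subseteq> T" by (auto simp: T_def dih_aff_def)
    show "T \<subseteq> dih_aff p 1 v ` T"
    proof clarify
      fix i b assume "(i, b) \<in> T"
      then have "(i, b) = dih_aff p 1 v ((i - v) mod int p, True)" "((i - v) mod int p, True) \<in> T"
        by (auto simp: T_def dih_aff_def mod_simps)
      then show "(i, b) \<in> dih_aff p 1 v ` T" by (rule image_eqI)
    qed
  qed
  have "{S \<in> conn_sets k. dih_aff p 1 v ` S = S} = (\<lambda>R. R \<union> T) ` {R. R \<subseteq> rotations \<and> card R + p = k}"
  proof (intro equalityI subsetI)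
    fix S assume "S \<in> {S \<in> conn_sets k. dih_aff p 1 v ` S = S}"
    then have S: "S \<subseteq> layered p - {(0, False)}" "card S = k" "\<exists>i. (i, True) \<in> S"
      "dih_aff p 1 v ` S = S" by (auto simp: conn_sets_def)
    have fwd: "((i + v) mod int p, True) \<in> S" if "(i mod int p, True) \<in> S" for i
    proof -
      have "dih_aff p 1 v (i mod int p, True) \<in> S" using that S(4) by blast
      then show ?thesis by (simp add: dih_aff_def mod_simps)
    qed
    have bwd: "(i mod int p, True) \<in> S" if "((i + v) mod int p, True) \<in> S" for i
    proof -
      have "((i + v) mod int p, True) \<in> dih_aff p 1 v ` S" using that S(4) by simp
      then obtain x where x: "x \<in> S" "dih_aff p 1 v x = ((i + v) mod int p, True)" by (metis imageE)
      then have xb: "snd x" "0 \<le> fst x" "fst x < int p" "(fst x + v) mod int p = (i + v) mod int p"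
        using S(1) by (auto simp: dih_aff_def layered_def)
      then have "fst x mod int p = i mod int p"
        by (metis add_diff_cancel_right' mod_diff_left_eq)
      then have "x = (i mod int p, True)" using xb by (simp add: prod_eq_iff)
      then show ?thesis using x by simp
    qed
    obtain j where j: "(j, True) \<in> S" using S(3) by blast
    then have "j mod int p = j" using S(1) by (auto simp: layered_def)
    moreover have "(i mod int p, True) \<in> S \<longleftrightarrow> ((i + v) mod int p, True) \<in> S" for i
      using fwd[of i] bwd[of i] by (rule iffI)
    then have "(i mod int p, True) \<in> S \<longleftrightarrow> (j mod int p, True) \<in> S" for i
      by (rule constant_if_invariant_under_step[where P = "\<lambda>i. (i, True) \<in> S", OF unit_not_dvd[OF v]])
    ultimately have "(i mod int p, True) \<in> S" for i using j by simp
    then have "(i, True) \<in> S" if "0 \<le> i" "i < int p" for i using that by (metis mod_eq_self)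
    then have TS: "T \<subseteq> S" by (auto simp: T_def)
    define R where "R = S \<inter> rotations"
    have SR: "S = R \<union> T" using S(1) TS by (auto simp: R_def rotations_eq T_def layered_def)
    have "R \<subseteq> rotations" by (simp add: R_def)
    moreover from this have "card R + p = k"
      using S(2) SR disj finT finite_subset[OF _ finR] by (simp add: card_Un_disjoint)
    ultimately show "S \<in> (\<lambda>R. R \<union> T) ` {R. R \<subseteq> rotations \<and> card R + p = k}" using SR by blast
  next
    fix S assume "S \<in> (\<lambda>R. R \<union> T) ` {R. R \<subseteq> rotations \<and> card R + p = k}"
    then obtain R where R: "R \<subseteq> rotations" "card R + p = k" "S = R \<union> T" by blast
    have "dih_aff p 1 v ` R = id ` R" using R(1) affR by (intro image_cong) auto
    then have "dih_aff p 1 v ` S = S" using affT by (simp add: R(3) image_Un)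
    moreover have "card S = k"
      using R disj finT finite_subset[OF R(1) finR] by (simp add: card_Un_disjoint)
    moreover have "(0, True) \<in> S" using p_gt_2 by (simp add: R(3) T_def)
    moreover have "S \<subseteq> layered p - {(0, False)}"
      using R(1) by (auto simp: R(3) rotations_def T_def layered_def)
    ultimately show "S \<in> {S \<in> conn_sets k. dih_aff p 1 v ` S = S}" by (auto simp: conn_sets_def)
  qed
  moreover have "inj_on (\<lambda>R. R \<union> T) {R. R \<subseteq> rotations \<and> card R + p = k}"
  proof (rule inj_onI)
    fix R R' assume R: "R \<in> {R. R \<subseteq> rotations \<and> card R + p = k}"
      "R' \<in> {R. R \<subseteq> rotations \<and> card R + p = k}" "R \<union> T = R' \<union> T"
    then have "R \<inter> T = {}" "R' \<inter> T = {}" using disj by blast+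
    then show "R = R'" using R(3) by blast
  qed
  ultimately have "card {S \<in> conn_sets k. dih_aff p 1 v ` S = S} =
      card {R. R \<subseteq> rotations \<and> card R + p = k}" by (simp add: card_image)
  also have "\<dots> = (if k \<ge> p then (p - 1) choose (k - p) else 0)"
  proof (cases "k \<ge> p")
    case True
    then have "{R. R \<subseteq> rotations \<and> card R + p = k} = {R. R \<subseteq> rotations \<and> card R = k - p}" by auto
    then show ?thesis using True n_subsets[OF finR] by (simp add: card_rotations)
  next
    case False
    then have "{R. R \<subseteq> rotations \<and> card R + p = k} = {}" by auto
    then show ?thesis using False by (simp only: card.empty if_False)
  qed
  finally show ?thesis .
qed

lemma card_fixed_conn_sets_one:
  "card {S \<in> conn_sets k. dih_aff p 1 0 ` S = S} + ((p - 1) choose k) = (2 * p - 1) choose k"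
proof -
  let ?W = "layered p - {(0, False)} :: (int \<times> bool) set"
  have V0: "(0, False) \<in> layered p" using p_gt_2 by (simp add: layered_def)
  have id: "dih_aff p 1 0 ` S = S" if "S \<subseteq> ?W" for S
  proof -
    have "dih_aff p 1 0 ` S = id ` S" using that dih_aff_one by (intro image_cong) auto
    then show ?thesis by simp
  qed
  have "fixed_sets 1 0 ?W k = {S. S \<subseteq> ?W \<and> card S = k}" unfolding fixed_sets_def using id by blast
  moreover have "fixed_sets 1 0 rotations k = {S. S \<subseteq> rotations \<and> card S = k}"
  proof -
    have "rotations \<subseteq> ?W" by (auto simp: rotations_eq)
    then have "dih_aff p 1 0 ` S = S" if "S \<subseteq> rotations" for S
      using id that by (meson subset_trans)
    then show ?thesis by (auto simp: fixed_sets_def)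
  qed
  moreover have "card ?W = 2 * p - 1" using V0 by (simp add: card_layered_bool finite_layered)
  moreover have "finite rotations" "finite ?W" by (simp_all add: rotations_def finite_layered)
  ultimately show ?thesis using card_fixed_conn_sets[of k 1 0] by (simp add: n_subsets card_rotations)
qed

text \<open>Apart from the identity and one fixed reflection \<open>c\<close>, all elements lie in
  cycles of length \<open>d\<close>. On the right the two terms count invariant sets without and
  with \<open>c\<close>; the extra term on the left counts those consisting of rotations.\<close>

lemma card_fixed_conn_sets_dilation:
  assumes u: "u \<in> {2..<int p}" and k: "k \<ge> 1" and d: "d = ord p (nat u)"
  shows "card {S \<in> conn_sets k. dih_aff p u v ` S = S} +
      (if d dvd k then ((p - 1) div d) choose (k div d) else 0) =
    (if d dvd k then (2 * (p - 1) div d) choose (k div d) else 0) +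
    (if d dvd k - 1 then (2 * (p - 1) div d) choose ((k - 1) div d) else 0)"
proof -
  let ?W = "layered p - {(0, False)} :: (int \<times> bool) set"
  have ndu: "\<not> int p dvd u" using u unit_not_dvd[of u] by simp
  have "\<not> int p dvd u - 1" using u unit_not_dvd[of "u - 1"] by simp
  \<comment> \<open>The fixed point of x \<mapsto> u x + v, unique because u - 1 is
    invertible.\<close>
  then obtain c where c: "0 \<le> c" "c < int p" "((u - 1) * c) mod int p = (- v) mod int p"
    using linear_congruence_solution by blast
  have dpos: "d > 0"
  proof -
    have "\<not> p dvd nat u" using ndu u by (simp add: int_dvd_int_iff[symmetric])
    then have "coprime p (nat u)" using prime_p prime_imp_coprime by blast
    then show ?thesis using ord_eq_0[of p "nat u"] d by (cases "d = 0") auto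
  qed
  have pow: "int p dvd u ^ n - 1 \<longleftrightarrow> d dvd n" for n
  proof -
    have "int p dvd u ^ n - 1 \<longleftrightarrow> [u ^ n = 1] (mod int p)" by (simp add: cong_iff_dvd_diff)
    also have "\<dots> \<longleftrightarrow> [nat u ^ n = 1] (mod p)"
    proof -
      have "[int (nat u ^ n) = int 1] (mod int p) \<longleftrightarrow> [nat u ^ n = 1] (mod p)"
        by (rule cong_int_iff)
      then show ?thesis using u by simp
    qed
    also have "\<dots> \<longleftrightarrow> d dvd n" unfolding d by (rule ord_divides)
    finally show ?thesis .
  qed
  define z where "z a = (if a then c else 0)" for a :: bool
  have fixz: "(u * z a + (if a then v else 0)) mod int p = z a mod int p" for a
  proof (cases a)
    case True
    have "u * c + v = (u - 1) * c + (c + v)" by (simp add: algebra_simps)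
    then have "(u * c + v) mod int p = (((u - 1) * c) mod int p + (c + v)) mod int p"
      by (simp only: mod_add_left_eq)
    also have "\<dots> = c mod int p" unfolding c(3) by (simp add: mod_simps)
    finally show ?thesis using True by (simp add: z_def)
  qed (simp add: z_def)
  \<comment> \<open>Around the fixed point \<open>z a\<close> of each layer the map is pure
    multiplication by \<open>u\<close>, so its period elsewhere is the order of
    \<open>u\<close>.\<close>
  have iter: "(dih_aff p u v ^^ n) (i, a) = ((u ^ n * (i - z a) + z a) mod int p, a)"
    if i: "0 \<le> i" "i < int p" for n i a
  proof (induction n)
    case 0
    then show ?case using i by simp
  next
    case (Suc n)
    have "(dih_aff p u v ^^ Suc n) (i, a) = dih_aff p u v ((u ^ n * (i - z a) + z a) mod int p, a)"
      by (simp only: funpow.simps comp_apply Suc.IH)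
    also have "\<dots> = ((u * (u ^ n * (i - z a) + z a) + (if a then v else 0)) mod int p, a)"
      by (simp add: dih_aff_def affine_mod_simps)
    finally have step: "(dih_aff p u v ^^ Suc n) (i, a) =
        ((u * (u ^ n * (i - z a) + z a) + (if a then v else 0)) mod int p, a)" .
    have "(u * (u ^ n * (i - z a) + z a) + (if a then v else 0)) mod int p =
        (u ^ Suc n * (i - z a) + (u * z a + (if a then v else 0))) mod int p"
      by (simp add: algebra_simps)
    also have "\<dots> = (u ^ Suc n * (i - z a) + (u * z a + (if a then v else 0)) mod int p) mod int p"
      by (simp add: mod_simps)
    also have "\<dots> = (u ^ Suc n * (i - z a) + z a) mod int p"
      unfolding fixz by (simp add: mod_simps)
    finally show ?case by (simp only: step)
  qed
  define E where "E = layered p - {(0, False), (c, True)}"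
  have zE: "i \<noteq> z a" if "(i, a) \<in> E" for i a
    using that by (cases a) (auto simp: E_def z_def)
  have period: "(dih_aff p u v ^^ n) x = x \<longleftrightarrow> d dvd n" if x: "x \<in> E" for x n
  proof -
    obtain i a where ia: "x = (i, a)" "0 \<le> i" "i < int p"
      using x by (cases x) (auto simp: E_def layered_def)
    have "\<not> int p dvd i - z a"
    proof
      assume "int p dvd i - z a"
      then have "i mod int p = z a mod int p" by (simp add: mod_eq_dvd_iff)
      moreover have "z a mod int p = z a" using c by (simp add: z_def)
      ultimately show False using ia zE[of i a] x by simp
    qed
    then have "int p dvd u ^ n - 1 \<longleftrightarrow> int p dvd (u ^ n - 1) * (i - z a)"
      using prime_int_p by (simp add: prime_dvd_mult_iff)
    also have "(u ^ n - 1) * (i - z a) = (u ^ n * (i - z a) + z a) - i" by (simp add: algebra_simps)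
    also have "int p dvd (u ^ n * (i - z a) + z a) - i \<longleftrightarrow>
        (u ^ n * (i - z a) + z a) mod int p = i mod int p" by (simp add: mod_eq_dvd_iff)
    also have "\<dots> \<longleftrightarrow> (dih_aff p u v ^^ n) x = x" using ia iter by simp
    finally show ?thesis using pow by blast
  qed
  have fixed_pt: "dih_aff p u v (0, False) = (0, False)" "dih_aff p u v (c, True) = (c, True)"
    using fixz[of True] c by (simp_all add: dih_aff_def z_def)
  have inj: "inj_on (dih_aff p u v) (layered p)" by (rule dih_aff_inj[OF ndu])
  have V: "(0, False) \<in> layered p" "(c, True) \<in> layered p" using c p_gt_2 by (simp_all add: layered_def)
  have closed: "dih_aff p u v x \<in> E" if x: "x \<in> E" for x
  proof -
    have "dih_aff p u v x \<noteq> dih_aff p u v y" if "y \<in> {(0, False), (c, True)}" for y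
      using inj_onD[OF inj, of x y] x V that by (auto simp: E_def)
    from this[of "(0, False)"] this[of "(c, True)"]
    have "dih_aff p u v x \<noteq> (0, False)" "dih_aff p u v x \<noteq> (c, True)" by (simp_all add: fixed_pt)
    then show ?thesis using dih_aff_closed[of u v x] by (simp add: E_def)
  qed
  have RE: "rotations \<subseteq> E" by (auto simp: rotations_def E_def layered_def)
  have closedR: "dih_aff p u v x \<in> rotations" if "x \<in> rotations" for x
  proof -
    have "dih_aff p u v x \<in> E" using closed RE that by blast
    moreover have "\<not> snd (dih_aff p u v x)" using that by (simp add: rotations_eq dih_aff_def)
    ultimately show ?thesis by (simp add: rotations_eq E_def)
  qed
  have periodR: "(dih_aff p u v ^^ n) x = x \<longleftrightarrow> d dvd n" if "x \<in> rotations" for x n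
    using that RE by (intro period) blast
  have finE: "finite E" by (simp add: E_def finite_layered)
  have cardE: "card E = 2 * (p - 1)"
    using V by (simp add: E_def card_Diff_subset card_layered_bool)
  have cntE: "card (fixed_sets u v E j) = (if d dvd j then (2 * (p - 1) div d) choose (j div d) else 0)" for j
    using card_invariant_subsets[OF finE dpos closed period, of j] by (simp add: fixed_sets_def cardE)
  have cntR: "card (fixed_sets u v rotations k) = (if d dvd k then ((p - 1) div d) choose (k div d) else 0)"
    using card_invariant_subsets[OF finite_subset[OF RE finE] dpos closedR periodR, of k]
    by (simp add: fixed_sets_def card_rotations)
  have W: "?W = insert (c, True) E" using V by (auto simp: E_def)
  have cE: "(c, True) \<notin> E" by (simp add: E_def)
  have split: "fixed_sets u v ?W k = fixed_sets u v E k \<union> insert (c, True) ` fixed_sets u v E (k - 1)"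
  proof (intro equalityI subsetI)
    fix S assume "S \<in> fixed_sets u v ?W k"
    then have S: "S \<subseteq> insert (c, True) E" "card S = k" "dih_aff p u v ` S = S"
      unfolding W by (auto simp: fixed_sets_def)
    have finS: "finite S" using S(1) finE finite_subset by blast
    show "S \<in> fixed_sets u v E k \<union> insert (c, True) ` fixed_sets u v E (k - 1)"
    proof (cases "(c, True) \<in> S")
      case True
      have "dih_aff p u v ` (S - {(c, True)}) = S - {(c, True)}"
      proof -
        have "S \<subseteq> layered p" using S(1) V by (auto simp: E_def)
        then have "dih_aff p u v ` (S - {(c, True)}) = dih_aff p u v ` S - dih_aff p u v ` {(c, True)}"
          using V by (intro inj_on_image_set_diff[OF inj]) auto
        then show ?thesis using S(3) fixed_pt by simp
      qed
      then have "S - {(c, True)} \<in> fixed_sets u v E (k - 1)"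
        using S True finS by (auto simp: fixed_sets_def)
      then show ?thesis using True by (metis UnI2 image_eqI insert_Diff)
    next
      case False
      then show ?thesis using S by (auto simp: fixed_sets_def)
    qed
  next
    fix S assume "S \<in> fixed_sets u v E k \<union> insert (c, True) ` fixed_sets u v E (k - 1)"
    then show "S \<in> fixed_sets u v ?W k"
    proof
      assume "S \<in> fixed_sets u v E k"
      then show ?thesis unfolding W by (auto simp: fixed_sets_def)
    next
      assume "S \<in> insert (c, True) ` fixed_sets u v E (k - 1)"
      then obtain S' where S': "S = insert (c, True) S'" "S' \<subseteq> E" "card S' = k - 1"
        "dih_aff p u v ` S' = S'" by (auto simp: fixed_sets_def)
      have "finite S'" "(c, True) \<notin> S'" using S' finE cE finite_subset by blast+
      then have "card S = k" using S' k by simp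
      moreover have "dih_aff p u v ` S = S" by (simp add: S'(1,4) fixed_pt)
      ultimately show ?thesis using S' unfolding W fixed_sets_def by blast
    qed
  qed
  have "card (fixed_sets u v ?W k) = card (fixed_sets u v E k) + card (fixed_sets u v E (k - 1))"
  proof -
    have "inj_on (insert (c, True)) (fixed_sets u v E (k - 1))"
    proof (rule inj_onI)
      fix S S' assume "S \<in> fixed_sets u v E (k - 1)" "S' \<in> fixed_sets u v E (k - 1)"
        and eq: "insert (c, True) S = insert (c, True) S'"
      then have "(c, True) \<notin> S" "(c, True) \<notin> S'" using cE by (auto simp: fixed_sets_def)
      with eq show "S = S'" by (simp add: insert_ident)
    qed
    moreover have "fixed_sets u v E k \<inter> insert (c, True) ` fixed_sets u v E (k - 1) = {}"
      using cE by (auto simp: fixed_sets_def)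
    ultimately show ?thesis unfolding split
      using finite_fixed_sets[OF finE] by (simp add: card_Un_disjoint card_image)
  qed
  then show ?thesis using card_fixed_conn_sets[of k u v] cntE cntR by simp
qed

section \<open>Summation over the affine group\<close>

text \<open>The unit group modulo p is cyclic of order p - 1, so each divisor \<open>d\<close> of p
  - 1 is the order of exactly \<open>totient d\<close> units.\<close>

lemma sum_over_units_by_order:
  fixes F :: "nat \<Rightarrow> real"
  shows "(\<Sum>u\<in>{1..<int p}. F (ord p (nat u))) = (\<Sum>d | d dvd p - 1. real (totient d) * F d)"
proof -
  have tot: "totatives p = {0<..<p}" using prime_p by (rule totatives_prime)
  have "(\<Sum>u\<in>{1..<int p}. F (ord p (nat u))) = (\<Sum>m\<in>totatives p. F (ord p m))"
    unfolding tot by (rule sum.reindex_bij_witness[of _ int nat]) auto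
  also have "\<dots> = (\<Sum>d | d dvd p - 1. \<Sum>m\<in>{m \<in> totatives p. ord p m = d}. F (ord p m))"
  proof (rule sum.group[symmetric])
    show "finite {d. d dvd p - 1}" using p_gt_2 by (intro finite_divisors_nat) simp
    show "ord p ` totatives p \<subseteq> {d. d dvd p - 1}"
      using order_divides_totient[of p] totient_prime[OF prime_p]
      by (auto simp: totatives_def coprime_commute)
  qed simp
  also have "\<dots> = (\<Sum>d | d dvd p - 1. real (card {m \<in> totatives p. ord p m = d}) * F d)"
    by (intro sum.cong HOL.refl) simp
  also have "\<dots> = (\<Sum>d | d dvd p - 1. real (totient d) * F d)"
    using p_gt_2 by (intro sum.cong HOL.refl)
      (simp add: prime_card_elements_with_ord_eq_totient[OF _ prime_p])
  finally show ?thesis .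
qed

lemma sum_divisors_gcd:
  fixes X :: "nat \<Rightarrow> nat"
  shows "(\<Sum>d | d dvd p - 1. real (totient d) * real (if d dvd n then X d else 0)) =
    (\<Sum>d | d dvd gcd (p - 1) n. real (totient d) * real (X d))"
proof -
  have "finite {d. d dvd p - 1}" using p_gt_2 by (intro finite_divisors_nat) simp
  then show ?thesis by (intro sum.mono_neutral_cong_right) auto
qed

text \<open>For u \<noteq> 1 the number of fixed sets is \<open>H (ord p (nat u))\<close> for each
  of the p values of v. The maps with u = 1 contribute \<open>H 1 + (p - 1) * C\<close> instead of
  \<open>p * H 1\<close>; this difference, divided by the group order, is the term with factor
  1/p.\<close>

lemma num_conn_Cayley_digraphs_formula:
  assumes k: "k \<ge> 2"
  shows "real (num_conn_Cayley_digraphs D k) = M_1 p k - M_c p k +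
    1 / real p * (real ((p - 1) choose k) + real (if k \<ge> p then (p - 1) choose (k - p) else 0) -
      real ((2 * p - 1) choose k))"
proof -
  define N where "N = card (orbits aff_group (conn_sets k) (aff_act k))"
  define f where "f d j = (if d dvd j then (2 * (p - 1) div d) choose (j div d) else 0)" for d j
  define h where "h d = (if d dvd k then ((p - 1) div d) choose (k div d) else 0)" for d
  define H where "H d = real (f d k) + real (f d (k - 1)) - real (h d)" for d
  define C where "C = (if k \<ge> p then (p - 1) choose (k - p) else 0)"
  define fx where "fx u v = card {S \<in> conn_sets k. dih_aff p u v ` S = S}" for u v
  have dil: "(\<Sum>v\<in>{0..<int p}. real (fx u v)) = real p * H (ord p (nat u))" if u: "u \<in> {2..<int p}" for u
  proof -
    have "real (fx u v) = H (ord p (nat u))" for v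
    proof -
      have "fx u v + h (ord p (nat u)) = f (ord p (nat u)) k + f (ord p (nat u)) (k - 1)"
        unfolding fx_def h_def f_def using card_fixed_conn_sets_dilation[OF u _ HOL.refl] k by simp
      then have "real (fx u v) + real (h (ord p (nat u))) =
          real (f (ord p (nat u)) k) + real (f (ord p (nat u)) (k - 1))" by (simp only: flip: of_nat_add)
      then show ?thesis by (simp add: H_def)
    qed
    then show ?thesis by simp
  qed
  \<comment> \<open>The dilation count at order 1 agrees with that of the identity: Pascal's rule
    joins the binomials for k and k - 1 into one from 2p - 1.\<close>
  have H1: "H 1 = real ((2 * p - 1) choose k) - real ((p - 1) choose k)"
  proof -
    have p2: "2 * p - 1 = Suc (2 * (p - 1))" using p_gt_2 by simp
    obtain j where j: "k = Suc j" using k by (cases k) auto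
    have "f 1 k + f 1 (k - 1) = (2 * p - 1) choose k" unfolding p2 j by (simp add: f_def)
    then have "real (f 1 k) + real (f 1 (k - 1)) = real ((2 * p - 1) choose k)"
      by (simp only: flip: of_nat_add)
    then show ?thesis by (simp add: H_def h_def)
  qed
  have one: "(\<Sum>v\<in>{0..<int p}. real (fx 1 v)) = H 1 + real (p - 1) * real C"
  proof -
    have "{0..<int p} = insert 0 {1..<int p}" using p_gt_2 by auto
    then have "(\<Sum>v\<in>{0..<int p}. real (fx 1 v)) = real (fx 1 0) + (\<Sum>v\<in>{1..<int p}. real (fx 1 v))"
      by simp
    also have "(\<Sum>v\<in>{1..<int p}. real (fx 1 v)) = (\<Sum>v\<in>{1..<int p}. real C)"
      by (intro sum.cong HOL.refl) (simp only: fx_def C_def card_fixed_conn_sets_translation)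
    also have "\<dots> = real (p - 1) * real C" using p_gt_2 by (simp add: nat_diff_distrib')
    also have "real (fx 1 0) = H 1"
    proof -
      have "real (fx 1 0) + real ((p - 1) choose k) = real ((2 * p - 1) choose k)"
        unfolding fx_def using card_fixed_conn_sets_one[of k] by (simp only: flip: of_nat_add)
      then show ?thesis using H1 by linarith
    qed
    finally show ?thesis .
  qed
  have split: "{1..<int p} = insert 1 {2..<int p}" using p_gt_2 by auto
  have total: "(\<Sum>u\<in>{1..<int p}. H (ord p (nat u))) = real (p - 1) * (M_1 p k - M_c p k)"
  proof -
    have "(\<Sum>u\<in>{1..<int p}. H (ord p (nat u))) = (\<Sum>d | d dvd p - 1. real (totient d) * H d)"
      by (rule sum_over_units_by_order)
    also have "\<dots> = (\<Sum>d | d dvd p - 1. real (totient d) * real (f d k)) +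
        (\<Sum>d | d dvd p - 1. real (totient d) * real (f d (k - 1))) -
        (\<Sum>d | d dvd p - 1. real (totient d) * real (h d))"
      by (simp add: H_def algebra_simps sum.distrib sum_subtractf)
    also have "\<dots> = real (p - 1) * (M_1 p k - M_c p k)"
    proof -
      have cancel: "a + b - c = q * (1 / q * (a + b) - 1 / q * c)" if "q \<noteq> 0" for a b c q :: real
        using that by (simp add: field_simps)
      show ?thesis
        unfolding f_def h_def sum_divisors_gcd M_1_def M_c_def by (rule cancel) (use p_gt_2 in simp)
    qed
    finally show ?thesis .
  qed
  have "real (N * ((p - 1) * p)) = real (\<Sum>u\<in>{1..<int p}. \<Sum>v\<in>{0..<int p}. fx u v)"
    unfolding N_def fx_def by (simp only: conn_sets_burnside)
  then have "real N * (real (p - 1) * real p) = (\<Sum>u\<in>{1..<int p}. \<Sum>v\<in>{0..<int p}. real (fx u v))"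
    by (simp only: of_nat_mult of_nat_sum)
  also have "\<dots> = (\<Sum>v\<in>{0..<int p}. real (fx 1 v)) + (\<Sum>u\<in>{2..<int p}. \<Sum>v\<in>{0..<int p}. real (fx u v))"
    unfolding split by simp
  also have "(\<Sum>u\<in>{2..<int p}. \<Sum>v\<in>{0..<int p}. real (fx u v)) =
      (\<Sum>u\<in>{2..<int p}. real p * H (ord p (nat u)))"
    by (intro sum.cong HOL.refl dil)
  also have "\<dots> = real p * ((\<Sum>u\<in>{1..<int p}. H (ord p (nat u))) - H 1)"
    unfolding split by (simp add: sum_distrib_left)
  finally have "real N * (real (p - 1) * real p) =
      H 1 + real (p - 1) * real C + real p * (real (p - 1) * (M_1 p k - M_c p k) - H 1)"
    by (simp only: one total)
  also have "\<dots> = (M_1 p k - M_c p k + 1 / real p * (real C - H 1)) * (real (p - 1) * real p)"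
    using p_gt_2 by (simp add: field_simps of_nat_diff)
  finally have "real N = M_1 p k - M_c p k + 1 / real p * (real C - H 1)"
    using p_gt_2 by simp
  moreover have "num_conn_Cayley_digraphs D k = N"
    using k by (simp add: num_conn_Cayley_digraphs_eq_orbits N_def)
  moreover have "real C - H 1 = real ((p - 1) choose k) +
      real (if k \<ge> p then (p - 1) choose (k - p) else 0) - real ((2 * p - 1) choose k)"
    unfolding H1 C_def by (rule diff_diff_eq2[THEN HOL.trans]) (simp only: add.commute)
  ultimately show ?thesis by (simp only:)
qed

text \<open>For k > p - 1 every common divisor \<open>d\<close> leaves k/d > (p-1)/d, so each
  binomial vanishes.\<close>

lemma M_c_eq_0:
  assumes "k \<ge> p"
  shows "M_c p k = 0"
proof -
  have zero: "((p - 1) div d) choose (k div d) = 0" if d: "d dvd gcd (p - 1) k" for d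
  proof -
    obtain a b where ab: "p - 1 = d * a" "k = d * b" using d by (auto elim!: dvdE)
    have "d * a < d * b" using assms p_gt_2 ab by linarith
    then have "a < b" "d > 0" by (auto intro: Nat.gr0I)
    then have "(p - 1) div d = a" "k div d = b" unfolding ab by simp_all
    then show ?thesis using \<open>a < b\<close> by simp
  qed
  have "(\<Sum>d | d dvd gcd (p - 1) k. real (totient d) * real (((p - 1) div d) choose (k div d))) = 0"
    by (intro sum.neutral ballI) (simp only: mem_Collect_eq zero of_nat_0 mult_zero_right)
  then show ?thesis by (simp only: M_c_def mult_zero_right)
qed

text \<open>In the first sum only d = 1 occurs and its binomial is 0. In the second all divisors of
  p - 1 occur with binomial 1, and their totients add up to p - 1.\<close>

lemma M_1_top: "M_1 p (2 * p - 1) = 1"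
proof -
  have g1: "gcd (p - 1) (2 * p - 1) = 1"
  proof -
    have "2 * p - 1 = 2 * (p - 1) + 1" using p_gt_2 by simp
    then show ?thesis by (metis coprime_add_one_right coprime_iff_gcd_eq_1 coprime_mult_left_iff
          coprime_commute mult.commute)
  qed
  have k1: "2 * p - 1 - 1 = 2 * (p - 1)" using p_gt_2 by simp
  have g2: "gcd (p - 1) (2 * (p - 1)) = p - 1" by simp
  have "(\<Sum>d | d dvd p - 1. real (totient d)) = real (p - 1)"
    using totient_divisor_sum[of "p - 1"] by (simp flip: of_nat_sum)
  moreover have "2 * (p - 1) choose (2 * p - 1) = 0" using p_gt_2 by simp
  ultimately show ?thesis using p_gt_2 unfolding M_1_def g1 k1 g2 by simp
qed

end

theorem theorem3p8:
  fixes p k :: nat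
  assumes "prime p" and "odd p" and "k \<le> 2 * p - 1"
  shows "(k \<in> {0, 1} \<longrightarrow>
            real (num_conn_Cayley_digraphs (dihedral_group p) k) = 0) \<and>
         (2 \<le> k \<and> k \<le> p - 1 \<longrightarrow>
            real (num_conn_Cayley_digraphs (dihedral_group p) k) = M p k - M_c p k) \<and>
         (p \<le> k \<and> k \<le> 2 * p - 1 \<longrightarrow>
            real (num_conn_Cayley_digraphs (dihedral_group p) k) = M p k)"
proof -
  interpret odd_prime p using assms by unfold_locales
  have "real (num_conn_Cayley_digraphs (dihedral_group p) k) = 0" if "k \<in> {0, 1}"
    using that by (auto simp: num_conn_Cayley_digraphs_eq_orbits)
  moreover have "real (num_conn_Cayley_digraphs (dihedral_group p) k) = M p k - M_c p k"
    if "2 \<le> k" "k \<le> p - 1"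
  proof -
    \<comment> \<open>Too few elements to contain all p reflections: the translation term is
      0.\<close>
    have "\<not> p \<le> k" "k \<noteq> 0" "k \<noteq> 2 * p - 1" using that p_gt_2 by linarith+
    then show ?thesis using that num_conn_Cayley_digraphs_formula[of k] by (simp add: M_def)
  qed
  moreover have "real (num_conn_Cayley_digraphs (dihedral_group p) k) = M p k"
    if k: "p \<le> k" "k \<le> 2 * p - 1"
  proof -
    have ne: "k \<noteq> 0" "\<not> k \<le> p - 1" "2 \<le> k" using k p_gt_2 by linarith+
    have eq: "real (num_conn_Cayley_digraphs (dihedral_group p) k) = M_1 p k +
        1 / real p * (real ((p - 1) choose (k - p)) - real ((2 * p - 1) choose k))"
      using num_conn_Cayley_digraphs_formula[OF ne(3)] M_c_eq_0[OF k(1)] k ne by simp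
    show ?thesis
    proof (cases "k = 2 * p - 1")
      case True
      \<comment> \<open>At the top degree both binomials with factor 1/p equal 1 and cancel, in
        accordance with the separate value 1 in \<open>M\<close>.\<close>
      have "k - p = p - 1" using True p_gt_2 by simp
      then show ?thesis using eq True M_1_top by (simp add: M_def)
    next
      case False
      then show ?thesis using eq ne by (simp add: M_def)
    qed
  qed
  ultimately show ?thesis by blast
qed

end
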